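(* Let $T$ be either a linear or a linearizable operator acting on functions defined on $\mathbb{R}^n$. Fix $1\le p,q<\infty$, $\theta>0$, and $1<s<\infty$. Suppose that there exists an increasing function $\phi:[1,\infty)\to[0,\infty)$ such that for all weights $w$ with $w^\theta\in A_s$ and each $f\in L^p(w^p)$, $$\|Tf\|_{L^q(w^q)}\le\phi\big([w^\theta]_{A_s}\big)\,\|f\|_{L^p(w^p)}.$$ Then, for each $b\in\mathcal{BMO}$ and for each weight $w$ and $1<\eta<\infty$ such that $w^{\theta\eta}\in A_s$, we have $$\big\|[T,b]f\big\|_{L^q(w^q)}\le\frac{\eta'\,\theta}{\min\{1,s-1\}}\,\phi\Big(4^{\frac{\min\{1,s-1\}}{\eta'}}\,[w^{\theta\eta}]_{A_s}^{1/\eta}\Big)\,\|b\|_{\mathcal{BMO}}\,\|f\|_{L^p(w^p)};$$ and, for every $k\ge2$, $$\big\|T_b^kf\big\|_{L^q(w^q)}\le k!\Big(\frac{\eta'\,\theta}{\min\{1,s-1\}}\Big)^k\,\phi\Big(4^{\frac{\min\{1,s-1\}}{\eta'}}\,[w^{\theta\eta}]_{A_s}^{1/\eta}\Big)\,\|b\|_{\mathcal{BMO}}^k\,\|f\|_{L^p(w^p)},$$ where $\frac1\eta+\frac1{\eta'}=1$.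
   Context: A weight is a non-negative locally integrable function on $\mathbb{R}^n$; $\|f\|_{L^p(w)}=(\int_{\mathbb{R}^n}|f|^p w\,dx)^{1/p}$. $Q$ denotes cubes in $\mathbb{R}^n$ with sides parallel to the axes and $f_Q=\frac1{|Q|}\int_Q f\,dx$. For $1<s<\infty$, $w\in A_s$ means $$[w]_{A_s}:=\sup_Q\Big(\frac1{|Q|}\int_Q w\,dx\Big)\Big(\frac1{|Q|}\int_Q w^{1-s'}\,dx\Big)^{s-1}<\infty,\qquad \tfrac1s+\tfrac1{s'}=1.$$ $\|f\|_{\exp L,Q}:=\inf\{\lambda>0:\ \frac1{|Q|}\int_Q e^{|f|/\lambda}\,dx\le 2\}$, and $\mathcal{BMO}$ is the space of locally integrable $b$ with $\|b\|_{\mathcal{BMO}}:=\sup_Q\|b-b_Q\|_{\exp L,Q}<\infty$. Commutators (defined whenever they make sense): for linear $T$, $T_b^1f=[T,b]f=T(bf)-b\,Tf$ and $T_b^k=[T_b^{k-1},b]$ for $k\ge2$; equivalently $T_b^kf(x)=T\big((b(\cdot)-b(x))^kf(\cdot)\big)(x)$. A sublinear operator $T$ is linearizable if there exist a Banach space $\mathbb{B}$ and a $\mathbb{B}$-valued linear operator $\mathcal{T}$ such that $Tf(x)=\|\mathcal{T}f(x)\|_{\mathbb{B}}$; in that case $T_b^kf(x):=\|\mathcal{T}_b^kf(x)\|_{\mathbb{B}}$ and $[T,b]f:=T^1_bf$. *)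

theory Defs
  imports "HOL-Analysis.Analysis"
begin

section \<open>Complex Banach spaces\<close>

class complex_banach = banach +
  fixes scaleC :: "complex \<Rightarrow> 'a \<Rightarrow> 'a" (infixr \<open>*\<^sub>C\<close> 75)
  assumes scaleC_add_right: "a *\<^sub>C (x + y) = a *\<^sub>C x + a *\<^sub>C y"
    and scaleC_add_left: "(a + b) *\<^sub>C x = a *\<^sub>C x + b *\<^sub>C x"
    and scaleC_scaleC: "a *\<^sub>C b *\<^sub>C x = (a * b) *\<^sub>C x"
    and scaleC_of_real: "complex_of_real r *\<^sub>C x = r *\<^sub>R x"
    and norm_scaleC: "norm (a *\<^sub>C x) = cmod a * norm x"

instantiation complex :: complex_banach
begin

definition scaleC_complex :: "complex \<Rightarrow> complex \<Rightarrow> complex"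
  where "scaleC_complex a x = a * x"

instance
  by standard (simp_all add: scaleC_complex_def algebra_simps norm_mult scaleR_conv_of_real)

end


section \<open>Weights, cubes and the Muckenhoupt classes\<close>

definition locally_integrable :: "(real^'n \<Rightarrow> 'a::{banach, second_countable_topology}) \<Rightarrow> bool"
  where "locally_integrable f \<longleftrightarrow> (\<forall>K. compact K \<longrightarrow> set_integrable lebesgue K f)"

definition weight :: "(real^'n \<Rightarrow> real) \<Rightarrow> bool"
  where "weight w \<longleftrightarrow> (\<forall>x. 0 \<le> w x) \<and> locally_integrable w"

definition cubes :: "(real^'n) set set"
  where "cubes = {cbox a (\<chi> i. a $ i + l) | a l. 0 < l}"

definition avg :: "(real^'n) set \<Rightarrow> (real^'n \<Rightarrow> 'a::{banach, second_countable_topology}) \<Rightarrow> 'a"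
  where "avg Q f = (LINT x:Q|lebesgue. f x) /\<^sub>R measure lebesgue Q"

definition conj_exp :: "real \<Rightarrow> real"
  where "conj_exp s = s / (s - 1)"

definition Ap_products :: "real \<Rightarrow> (real^'n \<Rightarrow> real) \<Rightarrow> real set"
  where "Ap_products s w =
    (\<lambda>Q. avg Q w * avg Q (\<lambda>x. w x powr (1 - conj_exp s)) powr (s - 1)) ` cubes"

text \<open>
  Finiteness of the constant includes finiteness of both averages on every cube.  Where \<open>w\<close>
  vanishes, the negative power \<open>w powr (1 - s')\<close> is mathematically infinite, while
  \<open>powr\<close> returns \<open>0\<close> there.  A weight with finite constant is positive almost everywhere
  (the zero weight being excluded, as usual), so positivity and local integrability of the negative
  power are required explicitly and the real-valued integrals and supremum below carry their
  intended meaning.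
\<close>

definition in_Ap :: "real \<Rightarrow> (real^'n \<Rightarrow> real) \<Rightarrow> bool"
  where "in_Ap s w \<longleftrightarrow> weight w \<and> (AE x in lebesgue. 0 < w x)
    \<and> locally_integrable (\<lambda>x. w x powr (1 - conj_exp s)) \<and> bdd_above (Ap_products s w)"

definition Ap_const :: "real \<Rightarrow> (real^'n \<Rightarrow> real) \<Rightarrow> real"
  where "Ap_const s w = Sup (Ap_products s w)"


section \<open>Weighted Lebesgue norms\<close>

definition ennreal_powr :: "ennreal \<Rightarrow> real \<Rightarrow> ennreal"
  where "ennreal_powr t a = (if t = \<infinity> then \<infinity> else ennreal (enn2real t powr a))"

definition Lp_norm :: "real \<Rightarrow> (real^'n \<Rightarrow> real) \<Rightarrow> (real^'n \<Rightarrow> complex) \<Rightarrow> ennreal"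
  where "Lp_norm p v f =
    ennreal_powr (\<integral>\<^sup>+ x. ennreal (cmod (f x) powr p * v x) \<partial>lebesgue) (1 / p)"

definition Lp_space :: "real \<Rightarrow> (real^'n \<Rightarrow> real) \<Rightarrow> (real^'n \<Rightarrow> complex) set"
  where "Lp_space p v = {f \<in> borel_measurable lebesgue. Lp_norm p v f < \<infinity>}"


section \<open>The space BMO with exponential oscillation\<close>

text \<open>Both norms are extended-valued; the infimum of the empty set is \<open>\<infinity>\<close>.\<close>

definition expL_norm :: "(real^'n) set \<Rightarrow> (real^'n \<Rightarrow> complex) \<Rightarrow> ennreal"
  where "expL_norm Q f = Inf {ennreal l | l. 0 < l \<and>
    (\<integral>\<^sup>+x\<in>Q. ennreal (exp (cmod (f x) / l)) \<partial>lebesgue) / emeasure lebesgue Q \<le> 2}"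

definition BMO_norm :: "(real^'n \<Rightarrow> complex) \<Rightarrow> ennreal"
  where "BMO_norm b = (SUP Q\<in>cubes. expL_norm Q (\<lambda>x. b x - avg Q b))"

definition BMO :: "(real^'n \<Rightarrow> complex) set"
  where "BMO = {b. locally_integrable b \<and> BMO_norm b < \<infinity>}"


section \<open>Operators and commutators\<close>

text \<open>
  An operator is a total function together with its domain \<open>D\<close>, a linear space of functions;
  its values outside \<open>D\<close> are irrelevant.  Output functions are only meaningful up to null
  sets, hence the almost everywhere identities.
\<close>

definition function_space :: "(real^'n \<Rightarrow> complex) set \<Rightarrow> bool"
  where "function_space D \<longleftrightarrow> (\<lambda>x. 0) \<in> D
    \<and> (\<forall>f\<in>D. \<forall>g\<in>D. (\<lambda>x. f x + g x) \<in> D) \<and> (\<forall>f\<in>D. \<forall>c. (\<lambda>x. c * f x) \<in> D)"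

definition linear_operator ::
  "(real^'n \<Rightarrow> complex) set \<Rightarrow> ((real^'n \<Rightarrow> complex) \<Rightarrow> real^'n \<Rightarrow> 'b::complex_banach) \<Rightarrow> bool"
  where "linear_operator D S \<longleftrightarrow>
    (\<forall>f\<in>D. \<forall>g\<in>D. AE x in lebesgue. S (\<lambda>y. f y + g y) x = S f x + S g x)
    \<and> (\<forall>f\<in>D. \<forall>c. AE x in lebesgue. S (\<lambda>y. c * f y) x = c *\<^sub>C S f x)"

definition linearized_by ::
  "(real^'n \<Rightarrow> complex) set \<Rightarrow> ((real^'n \<Rightarrow> complex) \<Rightarrow> real^'n \<Rightarrow> complex)
    \<Rightarrow> ((real^'n \<Rightarrow> complex) \<Rightarrow> real^'n \<Rightarrow> 'b::complex_banach) \<Rightarrow> bool"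
  where "linearized_by D T S \<longleftrightarrow> linear_operator D S
    \<and> (\<forall>f\<in>D. AE x in lebesgue. T f x = complex_of_real (norm (S f x)))"

definition commutator ::
  "((real^'n \<Rightarrow> complex) \<Rightarrow> real^'n \<Rightarrow> 'b::complex_banach) \<Rightarrow> (real^'n \<Rightarrow> complex)
    \<Rightarrow> (real^'n \<Rightarrow> complex) \<Rightarrow> real^'n \<Rightarrow> 'b"
  where "commutator S b f = (\<lambda>x. S (\<lambda>y. b y * f y) x - b x *\<^sub>C S f x)"

primrec iter_commutator ::
  "nat \<Rightarrow> ((real^'n \<Rightarrow> complex) \<Rightarrow> real^'n \<Rightarrow> 'b::complex_banach) \<Rightarrow> (real^'n \<Rightarrow> complex)
    \<Rightarrow> (real^'n \<Rightarrow> complex) \<Rightarrow> real^'n \<Rightarrow> 'b"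
  where
    "iter_commutator 0 S b = S"
  | "iter_commutator (Suc k) S b = commutator (iter_commutator k S b) b"

end

theory Submission
  imports Defs
begin

text \<open>
  The proof is the Cauchy integral trick: \<open>T_b^k f\<close> is the \<open>k\<close>-th Taylor coefficient, times \<open>k!\<close>,
  of \<open>z \<mapsto> exp (- z b) T (exp (z b) f)\<close>, and by conjugation the \<open>L^p(w^p)\<close> to \<open>L^q(w^q)\<close> bound of
  this operator is the bound of \<open>T\<close> for the weight \<open>w exp (- Re (z b))\<close>.  By Hoelder's inequality
  with exponents \<open>\<eta>\<close> and \<open>\<eta>'\<close> and by the exponential integrability of \<open>b\<close>, the power \<open>\<theta>\<close> of this weight
  has Muckenhoupt constant at most \<open>4 powr (min 1 (s - 1) / \<eta>') * [w powr (\<theta> \<eta>)] powr (1 / \<eta>)\<close> as long as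
  \<open>|z| < min 1 (s - 1) / (\<eta>' \<theta> \<parallel>b\<parallel>)\<close>; this radius gives the constant of the theorem.
\<close>

section \<open>Averages over cubes\<close>

text \<open>A priori nothing makes \<open>z \<mapsto> T (exp (z b) f) x\<close> analytic, or even
  continuous, for fixed \<open>x\<close>: linearity holds only up to null sets that depend on the
  arguments. The power series in \<open>z\<close> has to be extracted from the norm bounds, by
  showing that the Taylor remainders tend to zero almost everywhere. So the hypothesis is used a
  second time, and here lies an obstacle: remainders are controlled by
  \<open>exp (\<rho> |b|) |f|\<close>, while the available weights contain only
  \<open>exp (Re (z b))\<close>. Hence the decomposition into finitely many directions of
  \<open>b\<close>. The constants come from the two averages in the Muckenhoupt product. Each meets
  an exponential average bounded by a power of 2, whence the 4; Jensen's inequality needs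
  \<open>m \<le> 1\<close> for the first and \<open>m / (s - 1) \<le> 1\<close> for the second,
  whence \<open>m = min 1 (s - 1)\<close>. The Cauchy estimate at radius \<open>t\<close>
  contributes \<open>k! / t ^ k\<close>. Since the infimum in the exponential norm need not be
  attained and the norm of \<open>b\<close> may vanish, everything is done with a number above that
  norm, which decreases to it only at the very end.\<close>

lemma powr_mult_powr_le:
  fixes x y a c :: real
  assumes "0 < a" "0 < c" "a + c = 1" "0 \<le> x" "0 \<le> y"
  shows "x powr a * y powr c \<le> a * x + c * y"
proof (cases "x = 0 \<or> y = 0")
  case True
  then show ?thesis using assms by auto
next
  case False
  then show ?thesis using Youngs_inequality_0[of a c x y] assms by simp
qed

text \<open>Hoelder's inequality with exponents \<open>1 / a\<close> and \<open>1 / c\<close>. Once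
  both functions are divided by their integrals, Young's inequality holds pointwise and its right
  side integrates to \<open>a + c = 1\<close>.\<close>

lemma Holder_integral_powr:
  fixes F G :: "'a \<Rightarrow> real"
  assumes F: "integrable M F" "\<And>x. 0 \<le> F x" and G: "integrable M G" "\<And>x. 0 \<le> G x"
    and ac: "0 < a" "0 < c" "a + c = 1"
  shows "integrable M (\<lambda>x. F x powr a * G x powr c)"
    and "(\<integral>x. F x powr a * G x powr c \<partial>M) \<le> (\<integral>x. F x \<partial>M) powr a * (\<integral>x. G x \<partial>M) powr c"
proof -
  note [measurable] = borel_measurable_integrable[OF F(1)] borel_measurable_integrable[OF G(1)]
  show int: "integrable M (\<lambda>x. F x powr a * G x powr c)"
  proof (rule Bochner_Integration.integrable_bound)
    show "integrable M (\<lambda>x. a * F x + c * G x)" using F G by simp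
    show "AE x in M. norm (F x powr a * G x powr c) \<le> norm (a * F x + c * G x)"
      using powr_mult_powr_le[OF ac] F G ac by (auto intro!: AE_I2)
  qed measurable
  define A B where "A = (\<integral>x. F x \<partial>M)" and "B = (\<integral>x. G x \<partial>M)"
  have AB: "0 \<le> A" "0 \<le> B" unfolding A_def B_def using F G by auto
  show "(\<integral>x. F x powr a * G x powr c \<partial>M) \<le> (\<integral>x. F x \<partial>M) powr a * (\<integral>x. G x \<partial>M) powr c"
  proof (cases "A = 0 \<or> B = 0")
    case True
    then have "AE x in M. F x = 0 \<or> G x = 0"
      using integral_nonneg_eq_0_iff_AE[OF F(1)] integral_nonneg_eq_0_iff_AE[OF G(1)] F G
      unfolding A_def B_def by auto
    then have "AE x in M. F x powr a * G x powr c = 0" by eventually_elim auto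
    then have "(\<integral>x. F x powr a * G x powr c \<partial>M) = 0" by (rule integral_eq_zero_AE)
    then show ?thesis by simp
  next
    case False
    then have p: "0 < A" "0 < B" using AB by auto
    have pt: "F x powr a * G x powr c \<le> (A powr a * B powr c) * (a * (F x / A) + c * (G x / B))" for x
    proof -
      have "(F x / A) powr a * (G x / B) powr c \<le> a * (F x / A) + c * (G x / B)"
        using F G p by (intro powr_mult_powr_le ac) auto
      then have "(A powr a * B powr c) * ((F x / A) powr a * (G x / B) powr c)
          \<le> (A powr a * B powr c) * (a * (F x / A) + c * (G x / B))"
        by (rule mult_left_mono) simp
      moreover have "(A powr a * B powr c) * ((F x / A) powr a * (G x / B) powr c) = F x powr a * G x powr c"
        using p F(2)[of x] G(2)[of x] by (simp add: powr_divide)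
      ultimately show ?thesis by simp
    qed
    have "(\<integral>x. F x powr a * G x powr c \<partial>M)
        \<le> (\<integral>x. (A powr a * B powr c) * (a * (F x / A) + c * (G x / B)) \<partial>M)"
      using F G by (intro integral_mono int pt) auto
    also have "\<dots> = (A powr a * B powr c) * (a * (A / A) + c * (B / B))"
      using F(1) G(1) by (simp add: A_def B_def)
    also have "\<dots> = A powr a * B powr c" using p ac by simp
    finally show ?thesis by (simp add: A_def B_def)
  qed
qed

section \<open>Cubes, local integrability and elementary properties of averages\<close>

lemma cubes_facts:
  fixes Q :: "(real^'n) set"
  assumes "Q \<in> cubes"
  shows cubes_compact: "compact Q" and cubes_sets: "Q \<in> sets lebesgue"
    and cubes_measure_pos: "0 < measure lebesgue Q"
    and cubes_emeasure: "emeasure lebesgue Q = ennreal (measure lebesgue Q)"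
proof -
  obtain a :: "real^'n" and l where Q: "Q = cbox a (\<chi> i. a $ i + l)" and l: "0 < l"
    using assms unfolding cubes_def by auto
  show c: "compact Q" unfolding Q by (rule compact_cbox)
  show "Q \<in> sets lebesgue" unfolding Q by simp
  have "box a (\<chi> i. a $ i + l) \<noteq> {}"
    using l by (auto simp: box_ne_empty Basis_vec_def inner_axis)
  then show "0 < measure lebesgue Q"
    unfolding Q by (simp add: content_pos_lt_eq box_ne_empty)
  show "emeasure lebesgue Q = ennreal (measure lebesgue Q)"
    unfolding Q by (intro emeasure_eq_ennreal_measure) (simp add: emeasure_lborel_cbox_eq)
qed

lemma cubes_nonempty: "(cubes :: (real^'n) set set) \<noteq> {}"
  unfolding cubes_def by (auto intro: exI[of _ 1])

lemma compact_subset_cube: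
  fixes K :: "(real^'n) set"
  assumes "compact K"
  obtains Q where "Q \<in> cubes" "K \<subseteq> Q"
proof -
  obtain B where B: "0 < B" "\<And>x. x \<in> K \<Longrightarrow> norm x \<le> B"
    using compact_imp_bounded[OF assms] unfolding bounded_pos by blast
  define a :: "real^'n" where "a = (\<chi> i. - B)"
  have "K \<subseteq> cbox a (\<chi> i. a $ i + 2 * B)"
  proof
    fix x assume "x \<in> K"
    then have "\<bar>x $ i\<bar> \<le> B" for i using B(2) component_le_norm_cart[of x i] order_trans by blast
    then show "x \<in> cbox a (\<chi> i. a $ i + 2 * B)"
      by (auto simp: mem_box_cart a_def abs_le_iff minus_le_iff)
  qed
  moreover have "cbox a (\<chi> i. a $ i + 2 * B) \<in> cubes"
    unfolding cubes_def using B(1) by (auto intro!: exI[of _ a] exI[of _ "2*B"])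
  ultimately show ?thesis using that by blast
qed

lemma locally_integrable_iff_cubes:
  fixes f :: "real^'n \<Rightarrow> 'a::{banach, second_countable_topology}"
  shows "locally_integrable f \<longleftrightarrow> (\<forall>Q\<in>cubes. set_integrable lebesgue Q f)"
proof
  assume "locally_integrable f"
  then show "\<forall>Q\<in>cubes. set_integrable lebesgue Q f"
    unfolding locally_integrable_def using cubes_compact by blast
next
  assume *: "\<forall>Q\<in>cubes. set_integrable lebesgue Q f"
  show "locally_integrable f" unfolding locally_integrable_def
  proof (intro allI impI)
    fix K :: "(real^'n) set" assume K: "compact K"
    obtain Q where Q: "Q \<in> cubes" "K \<subseteq> Q" using compact_subset_cube[OF K] .
    show "set_integrable lebesgue K f"
      using * Q K by (intro set_integrable_subset[of lebesgue Q f K])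
        (auto intro: lmeasurable_compact fmeasurableD)
  qed
qed

lemma locally_integrable_borel_measurable:
  fixes f :: "real^'n \<Rightarrow> 'a::{banach, second_countable_topology}"
  assumes "locally_integrable f"
  shows "f \<in> borel_measurable lebesgue"
proof (rule borel_measurable_LIMSEQ_metric)
  fix i :: nat
  have "set_integrable lebesgue (cball (0::real^'n) (real i)) f"
    using assms unfolding locally_integrable_def by simp
  then show "(\<lambda>x. indicat_real (cball 0 (real i)) x *\<^sub>R f x) \<in> borel_measurable lebesgue"
    unfolding set_integrable_def by (rule borel_measurable_integrable)
next
  fix x :: "real^'n"
  have "eventually (\<lambda>i. indicat_real (cball 0 (real i)) x *\<^sub>R f x = f x) sequentially"
    using eventually_ge_at_top[of "nat \<lceil>norm x\<rceil>"]
    by eventually_elim (auto simp: indicator_def nat_ceiling_le_eq)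
  then show "(\<lambda>i. indicat_real (cball 0 (real i)) x *\<^sub>R f x) \<longlonglongrightarrow> f x"
    by (rule tendsto_eventually)
qed

lemma set_integrable_dominated:
  fixes F G :: "real^'n \<Rightarrow> real"
  assumes "set_integrable lebesgue Q G" "F \<in> borel_measurable lebesgue" "Q \<in> sets lebesgue"
    and "\<And>x. x \<in> Q \<Longrightarrow> \<bar>F x\<bar> \<le> G x"
  shows "set_integrable lebesgue Q F"
proof (rule set_integrable_bound[OF assms(1)])
  show "set_borel_measurable lebesgue Q F"
    using assms(2,3) by (simp add: set_borel_measurable_def)
  show "AE x in lebesgue. x \<in> Q \<longrightarrow> norm (F x) \<le> norm (G x)"
    using assms(4) by (intro AE_I2 impI) fastforce
qed

lemma set_integrable_const_cube:
  assumes "Q \<in> cubes"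
  shows "set_integrable lebesgue Q (\<lambda>x. c :: real)"
  unfolding set_integrable_def using cubes_sets[OF assms] cubes_emeasure[OF assms] by simp

lemma avg_const:
  fixes c :: real
  assumes "Q \<in> cubes"
  shows "avg Q (\<lambda>x. c) = c"
  using cubes_measure_pos[OF assms] cubes_sets[OF assms]
  by (simp add: avg_def set_lebesgue_integral_def mult.commute)

lemma avg_cmult: "avg Q (\<lambda>x. c * F x :: real) = c * avg Q F"
  by (simp add: avg_def)

lemma avg_add:
  fixes F G :: "real^'n \<Rightarrow> real"
  assumes "set_integrable lebesgue Q F" "set_integrable lebesgue Q G"
  shows "avg Q (\<lambda>x. F x + G x) = avg Q F + avg Q G"
  using assms by (simp add: avg_def set_integral_add algebra_simps)

lemma avg_mono_AE:
  fixes F G :: "real^'n \<Rightarrow> real"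
  assumes "set_integrable lebesgue Q F" "set_integrable lebesgue Q G" 
    and "AE x in lebesgue. x \<in> Q \<longrightarrow> F x \<le> G x"
  shows "avg Q F \<le> avg Q G"
proof -
  have "(LINT x:Q|lebesgue. F x) \<le> (LINT x:Q|lebesgue. G x)"
    using assms by (intro set_integral_mono_AE) auto
  then show ?thesis by (simp add: avg_def mult_left_mono)
qed

lemma avg_mono:
  fixes F G :: "real^'n \<Rightarrow> real"
  assumes "set_integrable lebesgue Q F" "set_integrable lebesgue Q G" "\<And>x. x \<in> Q \<Longrightarrow> F x \<le> G x"
  shows "avg Q F \<le> avg Q G"
  using assms by (intro avg_mono_AE) auto

lemma avg_nonneg:
  fixes F :: "real^'n \<Rightarrow> real"
  assumes "\<And>x. 0 \<le> F x"
  shows "0 \<le> avg Q F"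
  using assms by (simp add: avg_def set_lebesgue_integral_def)

lemma avg_cong_AE:
  fixes F G :: "real^'n \<Rightarrow> real"
  assumes "F \<in> borel_measurable lebesgue" "G \<in> borel_measurable lebesgue" "Q \<in> sets lebesgue"
    and "AE x in lebesgue. F x = G x"
  shows "avg Q F = avg Q G"
proof -
  have "(LINT x:Q|lebesgue. F x) = (LINT x:Q|lebesgue. G x)"
    unfolding set_lebesgue_integral_def using assms by (intro integral_cong_AE) auto
  then show ?thesis by (simp add: avg_def)
qed

lemma avg_pos:
  fixes F :: "real^'n \<Rightarrow> real"
  assumes Q: "Q \<in> cubes" and F: "set_integrable lebesgue Q F" "\<And>x. 0 \<le> F x" "AE x in lebesgue. 0 < F x"
  shows "0 < avg Q F"
proof -
  have "(LINT x:Q|lebesgue. F x) \<noteq> 0"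
  proof
    assume "(LINT x:Q|lebesgue. F x) = 0"
    then have "AE x in lebesgue. indicat_real Q x *\<^sub>R F x = 0"
      using F unfolding set_lebesgue_integral_def set_integrable_def
      by (subst integral_nonneg_eq_0_iff_AE[symmetric]) auto
    with F(3) have "AE x in lebesgue. x \<notin> Q" by eventually_elim (auto simp: indicator_def)
    then have "emeasure lebesgue Q = 0"
      using cubes_sets[OF Q] AE_iff_measurable[of Q lebesgue "\<lambda>x. x \<notin> Q"] by simp
    then show False using cubes_emeasure[OF Q] cubes_measure_pos[OF Q] by simp
  qed
  moreover have "0 \<le> (LINT x:Q|lebesgue. F x)"
    using F(2) by (simp add: set_lebesgue_integral_def)
  ultimately show ?thesis using cubes_measure_pos[OF Q] by (simp add: avg_def)
qed

lemma avg_Holder: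
  fixes F G :: "real^'n \<Rightarrow> real"
  assumes Q: "Q \<in> cubes" and F: "set_integrable lebesgue Q F" "\<And>x. 0 \<le> F x"
    and G: "set_integrable lebesgue Q G" "\<And>x. 0 \<le> G x"
    and ac: "0 < a" "0 < c" "a + c = 1"
  shows "set_integrable lebesgue Q (\<lambda>x. F x powr a * G x powr c)"
    and "avg Q (\<lambda>x. F x powr a * G x powr c) \<le> avg Q F powr a * avg Q G powr c"
proof -
  let ?F = "\<lambda>x. indicat_real Q x *\<^sub>R F x" and ?G = "\<lambda>x. indicat_real Q x *\<^sub>R G x"
  have eq: "?F x powr a * ?G x powr c = indicat_real Q x *\<^sub>R (F x powr a * G x powr c)" for x
    by (auto simp: indicator_def)
  note H = Holder_integral_powr[of lebesgue ?F ?G, OF _ _ _ _ ac]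
  show "set_integrable lebesgue Q (\<lambda>x. F x powr a * G x powr c)"
    using H(1) F G unfolding eq set_integrable_def by simp
  have le: "(LINT x:Q|lebesgue. F x powr a * G x powr c)
      \<le> (LINT x:Q|lebesgue. F x) powr a * (LINT x:Q|lebesgue. G x) powr c"
    using H(2) F G unfolding eq set_integrable_def set_lebesgue_integral_def by simp
  define m where "m = measure lebesgue Q"
  have m: "0 < m" using cubes_measure_pos[OF Q] by (simp add: m_def)
  have nn: "0 \<le> (LINT x:Q|lebesgue. F x)" "0 \<le> (LINT x:Q|lebesgue. G x)"
    using F(2) G(2) by (simp_all add: set_lebesgue_integral_def)
  \<comment> \<open>Since \<open>a + c = 1\<close>, the normalization by the measure of
    \<open>Q\<close> splits between the two factors.\<close>
  have "m = m powr a * m powr c" using m ac by (simp flip: powr_add)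
  with le show "avg Q (\<lambda>x. F x powr a * G x powr c) \<le> avg Q F powr a * avg Q G powr c"
    using m nn unfolding avg_def m_def[symmetric]
    by (simp add: powr_divide divide_inverse[symmetric] mult.commute[of "inverse m"] divide_right_mono)
qed

text \<open>Jensen's inequality for a concave power, obtained as Hoelder's inequality against the
  constant 1. The case \<open>a = 1\<close> is separate because \<open>avg_Holder\<close> wants a
  positive second exponent.\<close>

lemma avg_powr_le:
  fixes F :: "real^'n \<Rightarrow> real"
  assumes Q: "Q \<in> cubes" and F: "set_integrable lebesgue Q F" "\<And>x. 0 \<le> F x"
    and a: "0 < a" "a \<le> 1"
  shows "set_integrable lebesgue Q (\<lambda>x. F x powr a)" and "avg Q (\<lambda>x. F x powr a) \<le> avg Q F powr a"
proof -
  have "set_integrable lebesgue Q (\<lambda>x. F x powr a) \<and> avg Q (\<lambda>x. F x powr a) \<le> avg Q F powr a"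
  proof (cases "a = 1")
    case True
    then show ?thesis using F avg_nonneg[of F Q] by simp
  next
    case False
    then show ?thesis
      using avg_Holder[OF Q F set_integrable_const_cube[OF Q, of 1], of a "1 - a"] a
      by (simp add: avg_const[OF Q])
  qed
  then show "set_integrable lebesgue Q (\<lambda>x. F x powr a)" "avg Q (\<lambda>x. F x powr a) \<le> avg Q F powr a"
    by auto
qed

section \<open>Muckenhoupt constants and truncation\<close>

lemma one_minus_conj_exp: "1 < s \<Longrightarrow> 1 - conj_exp s = - (1 / (s - 1))"
  by (simp add: conj_exp_def field_simps)

lemma in_Ap_cubeD:
  assumes "in_Ap s w" "Q \<in> cubes"
  shows "set_integrable lebesgue Q w"
    and "set_integrable lebesgue Q (\<lambda>x. w x powr (1 - conj_exp s))"
    and "avg Q w * avg Q (\<lambda>x. w x powr (1 - conj_exp s)) powr (s - 1) \<le> Ap_const s w"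
proof -
  show "set_integrable lebesgue Q w"
    "set_integrable lebesgue Q (\<lambda>x. w x powr (1 - conj_exp s))"
    using assms unfolding in_Ap_def weight_def locally_integrable_iff_cubes by auto
  show "avg Q w * avg Q (\<lambda>x. w x powr (1 - conj_exp s)) powr (s - 1) \<le> Ap_const s w"
    unfolding Ap_const_def
    using assms by (intro cSup_upper) (auto simp: in_Ap_def Ap_products_def)
qed

lemma Ap_products_boundI:
  assumes "\<And>Q. Q \<in> cubes \<Longrightarrow> avg Q w * avg Q (\<lambda>x. w x powr (1 - conj_exp s)) powr (s - 1) \<le> C"
  shows "bdd_above (Ap_products s w)" and "Ap_const s w \<le> C"
proof -
  show "bdd_above (Ap_products s w)"
    using assms by (auto simp: Ap_products_def intro!: bdd_aboveI)
  show "Ap_const s w \<le> C"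
    unfolding Ap_const_def using assms cubes_nonempty
    by (intro cSup_least) (auto simp: Ap_products_def)
qed

text \<open>Hoelder's inequality on any one cube for \<open>w powr (1 / s)\<close> times its
  reciprocal, raised to the power \<open>s\<close>. It places the constants in \<open>{1..}\<close>,
  the range on which \<phi> is monotone and non-negative.\<close>

lemma Ap_const_ge_1:
  fixes w :: "real^'n \<Rightarrow> real"
  assumes "in_Ap s w" "1 < s"
  shows "1 \<le> Ap_const s w"
proof -
  obtain Q :: "(real^'n) set" where Q: "Q \<in> cubes" using cubes_nonempty by auto
  let ?v = "\<lambda>x. w x powr (1 - conj_exp s)"
  have w: "\<And>x. 0 \<le> w x" "AE x in lebesgue. 0 < w x"
    using assms(1) unfolding in_Ap_def weight_def by auto
  note I = in_Ap_cubeD[OF assms(1) Q]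
  have [measurable]: "w \<in> borel_measurable lebesgue"
    using assms(1) unfolding in_Ap_def weight_def by (auto intro: locally_integrable_borel_measurable)
  have ac: "0 < 1 / s" "0 < (s - 1) / s" "1 / s + (s - 1) / s = 1"
    using assms(2) by (auto simp: field_simps)
  have "avg Q (\<lambda>x. w x powr (1/s) * ?v x powr ((s-1)/s)) = avg Q (\<lambda>x. 1 :: real)"
  proof (rule avg_cong_AE)
    show "AE x in lebesgue. w x powr (1/s) * ?v x powr ((s-1)/s) = 1"
      using w(2)
    proof eventually_elim
      case (elim x)
      then show ?case using assms(2)
        by (simp add: one_minus_conj_exp powr_powr flip: powr_add)
    qed
    show "Q \<in> sets lebesgue" by (rule cubes_sets[OF Q])
  qed measurable
  then have 1: "1 \<le> avg Q w powr (1/s) * avg Q ?v powr ((s-1)/s)"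
    using avg_Holder(2)[OF Q I(1) w(1) I(2) _ ac] avg_const[OF Q, of 1] by simp
  have "1 \<le> (avg Q w powr (1/s) * avg Q ?v powr ((s-1)/s)) powr s"
    using powr_mono2[of s 1, OF _ _ 1] assms(2) by simp
  also have "\<dots> = avg Q w * avg Q ?v powr (s - 1)"
    using assms(2) avg_nonneg[of w Q, OF w(1)] by (simp add: powr_mult powr_powr)
  also have "\<dots> \<le> Ap_const s w" by (rule I(3))
  finally show ?thesis .
qed

text \<open>
  With \<open>c = avg u / avg (min u n)\<close>, the tangent to \<open>t powr (- a)\<close> at \<open>c\<close>, evaluated at
  \<open>t = u / min u n\<close>, bounds \<open>avg (u powr (- a))\<close> from below.
\<close>
lemma avg_truncate_le:
  fixes u :: "real^'n \<Rightarrow> real"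
  assumes Q: "Q \<in> cubes" and u: "\<And>x. 0 \<le> u x" "AE x in lebesgue. 0 < u x"
    and int: "set_integrable lebesgue Q u" "set_integrable lebesgue Q (\<lambda>x. u x powr (- a))"
    and [measurable]: "u \<in> borel_measurable lebesgue"
    and an: "0 < a" "0 < n"
  shows "set_integrable lebesgue Q (\<lambda>x. min (u x) n)"
    and "set_integrable lebesgue Q (\<lambda>x. min (u x) n powr (- a))"
    and "avg Q (\<lambda>x. min (u x) n) * avg Q (\<lambda>x. min (u x) n powr (- a)) powr (1 / a)
      \<le> avg Q u * avg Q (\<lambda>x. u x powr (- a)) powr (1 / a)"
proof -
  define Y where "Y = (\<lambda>x. min (u x) n)"
  have Ym[measurable]: "Y \<in> borel_measurable lebesgue" unfolding Y_def by measurable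
  have Y0: "0 \<le> Y x" for x using u(1) an by (simp add: Y_def)
  have Ypos: "AE x in lebesgue. 0 < Y x" using u(2) an by (auto simp: Y_def)
  note Qs = cubes_sets[OF Q]
  show intY: "set_integrable lebesgue Q (\<lambda>x. min (u x) n)"
    by (rule set_integrable_dominated[OF int(1) _ Qs]) (use u an in auto)
  show intYa: "set_integrable lebesgue Q (\<lambda>x. min (u x) n powr (- a))"
  proof (rule set_integrable_dominated[OF _ _ Qs])
    show "set_integrable lebesgue Q (\<lambda>x. u x powr (- a) + n powr (- a))"
      using int set_integrable_const_cube[OF Q] by simp
  qed (auto simp: min_def)
  have iY: "set_integrable lebesgue Q Y" and iYa: "set_integrable lebesgue Q (\<lambda>x. Y x powr (- a))"
    using intY intYa by (simp_all add: Y_def)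
  define A B A' B' where "A = avg Q u" and "B = avg Q (\<lambda>x. u x powr (- a))"
    and "A' = avg Q Y" and "B' = avg Q (\<lambda>x. Y x powr (- a))"
  have A': "0 < A'" unfolding A'_def by (rule avg_pos[OF Q iY Y0 Ypos])
  have AA: "A' \<le> A" unfolding A_def A'_def
    by (rule avg_mono[OF iY int(1)]) (simp add: Y_def)
  have A'n: "A' \<le> n"
    unfolding A'_def using avg_mono[OF iY set_integrable_const_cube[OF Q, of n]] avg_const[OF Q, of n]
    by (simp add: Y_def)
  have B'n: "n powr (- a) \<le> B'"
  proof -
    have "avg Q (\<lambda>x. n powr (- a)) \<le> B'" unfolding B'_def
    proof (rule avg_mono_AE[OF set_integrable_const_cube[OF Q] iYa])
      show "AE x in lebesgue. x \<in> Q \<longrightarrow> n powr (- a) \<le> Y x powr (- a)"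
        using Ypos
      proof eventually_elim
        case (elim x)
        then show ?case using an by (auto simp: Y_def intro!: powr_mono2')
      qed
    qed
    then show ?thesis by (simp add: avg_const[OF Q])
  qed
  have B0: "0 \<le> B" unfolding B_def by (rule avg_nonneg) simp
  \<comment> \<open>With \<open>A = c * A'\<close> the claim becomes
    \<open>c powr (- a) * B' \<le> B\<close>, which is \<open>key\<close> below.\<close>
  define c where "c = A / A'"
  have c: "1 \<le> c" "A = c * A'" using A' AA by (auto simp: c_def)
  have tangent: "t powr (- a) \<ge> c powr (- a) - a * c powr (- a - 1) * (t - c)" if "0 < t" for t
  proof -
    have "c powr (- a) + a * c powr (- a - 1) * c - a * c powr (-a-1) * t \<le> t powr (-a)"
      using that c(1) an
    proof -
      define r where "r = t / c"
      have r: "0 < r" "t = r * c" using that c(1) by (auto simp: r_def)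
      have "1 + (- a) * ln r \<le> r powr (- a)"
        using exp_ge_add_one_self[of "(- a) * ln r"] r by (simp add: powr_def)
      moreover have "ln r \<le> r - 1" using r by (simp add: ln_le_minus_one)
      then have "a * ln r \<le> a * (r - 1)" using an by simp
      ultimately have "1 + a - a * r \<le> r powr (- a)" by (simp add: algebra_simps)
      then have "c powr (-a) * (1 + a - a * r) \<le> c powr (-a) * r powr (- a)" by (simp add: mult_left_mono)
      moreover have "c powr (-a-1) = c powr (-a) / c" using c(1) by (simp add: powr_diff)
      ultimately show ?thesis using c(1) r by (simp add: powr_mult algebra_simps)
    qed
    then show ?thesis by (simp add: algebra_simps)
  qed
  \<comment> \<open>\<open>u\<close> and \<open>Y\<close> differ only where \<open>Y = n\<close>.
    Therefore \<open>Y powr (- a) * (u / Y - 1)\<close> equals \<open>k * (u - Y)\<close>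
    everywhere, and the tangent bound becomes linear in \<open>u\<close>, \<open>Y\<close> and
    \<open>Y powr (- a)\<close>, whose averages are known.\<close>
  define k where "k = n powr (- a - 1)"
  have pt: "c powr (- a) * Y x powr (- a)
      - a * c powr (- a - 1) * (k * (u x - Y x) + (1 - c) * Y x powr (- a)) \<le> u x powr (- a)"
    if "0 < u x" for x
  proof -
    have Yx: "0 < Y x" using that an by (simp add: Y_def)
    have "Y x powr (- a) * (u x / Y x - 1) = k * (u x - Y x)"
    proof (cases "u x \<le> n")
      case True
      then show ?thesis using Yx by (simp add: Y_def)
    next
      case False
      then have "Y x = n" by (simp add: Y_def)
      then show ?thesis using an by (simp add: k_def powr_diff field_simps)
    qed
    then have eq: "Y x powr (- a) * (u x / Y x - c) = k * (u x - Y x) + (1 - c) * Y x powr (- a)"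
      by (simp add: algebra_simps)
    have "Y x powr (- a) * (c powr (- a) - a * c powr (- a - 1) * (u x / Y x - c))
        \<le> Y x powr (- a) * (u x / Y x) powr (- a)"
      by (intro mult_left_mono tangent) (use that Yx in auto)
    also have "\<dots> = u x powr (- a)" using that Yx by (simp add: powr_divide)
    also have "Y x powr (- a) * (c powr (- a) - a * c powr (- a - 1) * (u x / Y x - c))
      = c powr (- a) * Y x powr (- a) - a * c powr (- a - 1) * (Y x powr (- a) * (u x / Y x - c))"
      by (simp add: algebra_simps)
    finally show ?thesis unfolding eq .
  qed
  have iL: "set_integrable lebesgue Q (\<lambda>x. c powr (- a) * Y x powr (- a)
      - a * c powr (- a - 1) * (k * (u x - Y x) + (1 - c) * Y x powr (- a)))"
    by (intro set_integral_diff(1) set_integral_add(1) set_integrable_mult_right iY iYa int)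
  have "avg Q (\<lambda>x. c powr (- a) * Y x powr (- a)
      - a * c powr (- a - 1) * (k * (u x - Y x) + (1 - c) * Y x powr (- a))) \<le> B"
    unfolding B_def
    by (rule avg_mono_AE[OF iL int(2)]) (use u(2) pt in \<open>auto elim!: eventually_mono\<close>)
  moreover have "avg Q (\<lambda>x. c powr (- a) * Y x powr (- a)
      - a * c powr (- a - 1) * (k * (u x - Y x) + (1 - c) * Y x powr (- a)))
    = c powr (- a) * B' - a * c powr (- a - 1) * (k * (A - A') + (1 - c) * B')"
  proof -
    have eq: "(\<lambda>x. c powr (- a) * Y x powr (- a)
      - a * c powr (- a - 1) * (k * (u x - Y x) + (1 - c) * Y x powr (- a)))
      = (\<lambda>x. (c powr (- a) - a * c powr (- a - 1) * (1 - c)) * Y x powr (- a)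
        + ((- a * c powr (- a - 1) * k) * u x + (a * c powr (- a - 1) * k) * Y x))"
      by (rule ext) (simp add: algebra_simps)
    have lin: "avg Q (\<lambda>x. \<alpha> * Y x powr (- a) + (\<beta> * u x + \<gamma> * Y x))
        = \<alpha> * B' + (\<beta> * A + \<gamma> * A')" for \<alpha> \<beta> \<gamma>
    proof -
      have i: "set_integrable lebesgue Q (\<lambda>x. \<alpha> * Y x powr (- a))" "set_integrable lebesgue Q (\<lambda>x. \<beta> * u x)"
        "set_integrable lebesgue Q (\<lambda>x. \<gamma> * Y x)"
        using iYa iY int(1) by simp_all
      show ?thesis
        using avg_add[OF i(1) set_integral_add(1)[OF i(2,3)]] avg_add[OF i(2,3)]
        by (simp add: avg_cmult A_def A'_def B'_def)
    qed
    show ?thesis unfolding eq lin by (simp add: algebra_simps)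
  qed
  \<comment> \<open>The left side is \<open>(c - 1) * (k * A' - B')\<close>, and
    \<open>k * A' \<le> k * n = n powr (- a) \<le> B'\<close>.\<close>
  moreover have "k * (A - A') + (1 - c) * B' \<le> 0"
  proof -
    have "k * A' \<le> k * n" using A'n by (simp add: k_def mult_left_mono)
    also have "\<dots> = n powr (- a)" using an by (simp add: k_def powr_diff)
    also have "\<dots> \<le> B'" by (rule B'n)
    finally have "(c - 1) * (k * A') \<le> (c - 1) * B'" using c(1) by (intro mult_left_mono) auto
    then show ?thesis unfolding c(2) by (simp add: algebra_simps)
  qed
  then have "a * c powr (- a - 1) * (k * (A - A') + (1 - c) * B') \<le> 0"
    using an by (simp add: mult_nonneg_nonpos)
  ultimately have key: "c powr (- a) * B' \<le> B" by linarith
  have B'0: "0 \<le> B'" unfolding B'_def by (rule avg_nonneg) simp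
  have "A' * B' powr (1/a) = A * (c powr (- a) * B') powr (1/a)"
    using c an B'0 by (simp add: powr_divide powr_powr powr_minus_divide)
  also have "\<dots> \<le> A * B powr (1/a)"
    using key an B'0 A' AA by (intro mult_left_mono powr_mono2) auto
  finally show "avg Q (\<lambda>x. min (u x) n) * avg Q (\<lambda>x. min (u x) n powr (- a)) powr (1 / a)
      \<le> avg Q u * avg Q (\<lambda>x. u x powr (- a)) powr (1 / a)"
    unfolding A_def B_def A'_def B'_def Y_def .
qed

text \<open>Supplies bounded approximations of a weight with uniformly controlled constants:
  \<open>avg_truncate_le\<close> with \<open>a = 1 / (s - 1)\<close>, cube by cube.\<close>

lemma in_Ap_truncate:
  fixes u :: "real^'n \<Rightarrow> real"
  assumes "in_Ap s u" "1 < s" "0 < n"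
  shows "in_Ap s (\<lambda>x. min (u x) n)" and "Ap_const s (\<lambda>x. min (u x) n) \<le> Ap_const s u"
proof -
  define a where "a = 1 / (s - 1)"
  have a: "0 < a" "1 - conj_exp s = - a" "s - 1 = 1 / a"
    using assms(2) one_minus_conj_exp[OF assms(2)] by (auto simp: a_def)
  have u: "\<And>x. 0 \<le> u x" "AE x in lebesgue. 0 < u x" "u \<in> borel_measurable lebesgue"
    using assms(1) unfolding in_Ap_def weight_def by (auto intro: locally_integrable_borel_measurable)
  have T: "set_integrable lebesgue Q (\<lambda>x. min (u x) n)"
      "set_integrable lebesgue Q (\<lambda>x. min (u x) n powr (1 - conj_exp s))"
      "avg Q (\<lambda>x. min (u x) n) * avg Q (\<lambda>x. min (u x) n powr (1 - conj_exp s)) powr (s - 1)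
        \<le> Ap_const s u" if "Q \<in> cubes" for Q
    using avg_truncate_le[OF that u(1,2) _ _ u(3) a(1) assms(3)] in_Ap_cubeD[OF assms(1) that]
    unfolding a(2,3) by auto
  show "Ap_const s (\<lambda>x. min (u x) n) \<le> Ap_const s u"
    using T(3) by (rule Ap_products_boundI)
  show "in_Ap s (\<lambda>x. min (u x) n)"
    unfolding in_Ap_def weight_def locally_integrable_iff_cubes
    using T(1,2) u(1,2) assms(3) Ap_products_boundI(1)[OF T(3)] by auto
qed

section \<open>Exponentials of BMO functions as multipliers of weights\<close>

text \<open>The strict inequality gives on each cube an admissible number
  \<open>l < \<beta>\<close>, and the exponential average decreases when \<open>l\<close> is
  replaced by \<beta>. So no attained infimum and no non-zero norm is required.\<close>

lemma BMO_exp_avg_le: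
  fixes b :: "real^'n \<Rightarrow> complex"
  assumes b: "b \<in> BMO" "BMO_norm b < ennreal \<beta>" and \<beta>: "0 < \<beta>" and Q: "Q \<in> cubes"
  shows "set_integrable lebesgue Q (\<lambda>x. exp (cmod (b x - avg Q b) / \<beta>))"
    and "avg Q (\<lambda>x. exp (cmod (b x - avg Q b) / \<beta>)) \<le> 2"
proof -
  define h where "h = (\<lambda>x. cmod (b x - avg Q b))"
  define m where "m = measure lebesgue Q"
  have [measurable]: "b \<in> borel_measurable lebesgue"
    using b(1) unfolding BMO_def by (auto intro: locally_integrable_borel_measurable)
  have [measurable]: "h \<in> borel_measurable lebesgue" unfolding h_def by measurable
  have [measurable]: "Q \<in> sets lebesgue" by (rule cubes_sets[OF Q])
  have m: "0 < m" "emeasure lebesgue Q = ennreal m"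
    using cubes_measure_pos[OF Q] cubes_emeasure[OF Q] by (simp_all add: m_def)
  have "expL_norm Q (\<lambda>x. b x - avg Q b) < ennreal \<beta>"
    using b(2) Q unfolding BMO_norm_def by (metis (mono_tags, lifting) SUP_lessD)
  then obtain l where l: "0 < l" "ennreal l < ennreal \<beta>"
    "(\<integral>\<^sup>+x\<in>Q. ennreal (exp (h x / l)) \<partial>lebesgue) / emeasure lebesgue Q \<le> 2"
    unfolding expL_norm_def Inf_less_iff h_def by blast
  have l\<beta>: "l \<le> \<beta>" using l by (simp add: ennreal_less_iff)
  have "(\<integral>\<^sup>+x\<in>Q. ennreal (exp (h x / l)) \<partial>lebesgue)
      = (\<integral>\<^sup>+x\<in>Q. ennreal (exp (h x / l)) \<partial>lebesgue) / ennreal m * ennreal m"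
    using m by (simp add: ennreal_divide_times ennreal_mult_divide_eq)
  also have "\<dots> \<le> 2 * ennreal m" using l(3) m by (intro mult_right_mono) auto
  finally have le1: "(\<integral>\<^sup>+x\<in>Q. ennreal (exp (h x / l)) \<partial>lebesgue) \<le> ennreal (2 * m)"
    using m by (simp add: ennreal_mult)
  have le: "(\<integral>\<^sup>+x. ennreal (indicat_real Q x *\<^sub>R exp (h x / \<beta>)) \<partial>lebesgue) \<le> ennreal (2 * m)"
  proof (rule order_trans[OF nn_integral_mono le1])
    fix x
    have "h x / \<beta> \<le> h x / l" using l l\<beta> by (intro divide_left_mono) (auto simp: h_def)
    then show "ennreal (indicat_real Q x *\<^sub>R exp (h x / \<beta>)) \<le> ennreal (exp (h x / l)) * indicator Q x"
      by (auto simp: indicator_def intro: ennreal_leI)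
  qed
  have int: "integrable lebesgue (\<lambda>x. indicat_real Q x *\<^sub>R exp (h x / \<beta>))"
  proof (rule integrableI_nonneg)
    show "(\<integral>\<^sup>+x. ennreal (indicat_real Q x *\<^sub>R exp (h x / \<beta>)) \<partial>lebesgue) < \<infinity>"
      using le by (rule order_le_less_trans) simp
  qed auto
  then show "set_integrable lebesgue Q (\<lambda>x. exp (cmod (b x - avg Q b) / \<beta>))"
    unfolding set_integrable_def h_def .
  have "ennreal (\<integral>x. indicat_real Q x *\<^sub>R exp (h x / \<beta>) \<partial>lebesgue) \<le> ennreal (2 * m)"
    using le by (subst nn_integral_eq_integral[OF int, symmetric]) auto
  then have "(LINT x:Q|lebesgue. exp (h x / \<beta>)) \<le> 2 * m"
    using m(1) unfolding set_lebesgue_integral_def by simp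
  then have "avg Q (\<lambda>x. exp (h x / \<beta>)) \<le> 2"
    using m(1) unfolding avg_def m_def[symmetric] by (simp add: field_simps)
  then show "avg Q (\<lambda>x. exp (cmod (b x - avg Q b) / \<beta>)) \<le> 2" unfolding h_def .
qed

text \<open>Jensen's inequality turns the bound 2 for \<open>exp X\<close> into
  \<open>2 powr t\<close> for \<open>exp (t X)\<close>; this is where \<open>t \<le> 1\<close>
  enters and what finally forces the minimum of 1 and \<open>s - 1\<close>.\<close>

lemma avg_exp_le:
  fixes U X :: "real^'n \<Rightarrow> real"
  assumes Q: "Q \<in> cubes" and [measurable]: "U \<in> borel_measurable lebesgue"
    and X: "set_integrable lebesgue Q (\<lambda>x. exp (X x))" "avg Q (\<lambda>x. exp (X x)) \<le> 2"
    and t: "0 < t" "t \<le> 1" and le: "\<And>x. U x \<le> c + t * X x"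
  shows "set_integrable lebesgue Q (\<lambda>x. exp (U x))" and "avg Q (\<lambda>x. exp (U x)) \<le> exp c * 2 powr t"
proof -
  note J = avg_powr_le[OF Q X(1) _ t]
  have pt: "exp (U x) \<le> exp c * exp (X x) powr t" for x
    using le[of x] by (simp add: exp_powr_real mult.commute flip: exp_add)
  have int: "set_integrable lebesgue Q (\<lambda>x. exp c * exp (X x) powr t)" using J(1) by simp
  show int': "set_integrable lebesgue Q (\<lambda>x. exp (U x))"
    by (rule set_integrable_dominated[OF int _ cubes_sets[OF Q]]) (use pt in auto)
  have "avg Q (\<lambda>x. exp (U x)) \<le> avg Q (\<lambda>x. exp c * exp (X x) powr t)"
    by (rule avg_mono[OF int' int pt])
  also have "\<dots> \<le> exp c * avg Q (\<lambda>x. exp (X x)) powr t"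
    unfolding avg_cmult by (intro mult_left_mono J(2)) auto
  also have "\<dots> \<le> exp c * 2 powr t"
    using X(2) t avg_nonneg[of "\<lambda>x. exp (X x)" Q] by (intro mult_left_mono powr_mono2) auto
  finally show "avg Q (\<lambda>x. exp (U x)) \<le> exp c * 2 powr t" .
qed

text \<open>Hoelder's inequality separates \<open>W\<close> from the exponential in both averages of
  the Muckenhoupt product. The exponential factors are estimated relative to a centre
  \<open>u\<close> depending on the cube; \<open>exp u\<close> from the first average cancels
  \<open>exp (- u)\<close> from the second, so the bound is uniform in the cube.\<close>

lemma Ap_exp_perturbation:
  fixes W U :: "real^'n \<Rightarrow> real"
  assumes W: "in_Ap s W" and s: "1 < s" and ac: "0 < a" "0 < c" "a + c = 1"
    and U[measurable]: "U \<in> borel_measurable lebesgue"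
    and osc: "\<And>Q. Q \<in> cubes \<Longrightarrow> \<exists>u X. set_integrable lebesgue Q (\<lambda>x. exp (X x))
      \<and> avg Q (\<lambda>x. exp (X x)) \<le> 2 \<and> (\<forall>x. \<bar>U x - u\<bar> \<le> min 1 (s - 1) * X x)"
  shows "in_Ap s (\<lambda>x. W x powr a * exp (c * U x))"
    and "Ap_const s (\<lambda>x. W x powr a * exp (c * U x)) \<le> 4 powr (min 1 (s - 1) * c) * Ap_const s W powr a"
proof -
  define V where "V = (\<lambda>x. W x powr a * exp (c * U x))"
  define \<kappa> where "\<kappa> = 1 / (s - 1)"
  \<comment> \<open>The largest \<open>m\<close> for which both \<open>m\<close> and
    \<open>\<kappa> * m\<close> are at most 1, as \<open>avg_exp_le\<close> demands for
    \<open>U\<close> and for \<open>- \<kappa> * U\<close>.\<close>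
  define m where "m = min 1 (s - 1)"
  have \<kappa>: "0 < \<kappa>" "1 - conj_exp s = - \<kappa>" "\<kappa> * (s - 1) = 1"
    using s one_minus_conj_exp[OF s] by (auto simp: \<kappa>_def)
  have m: "0 < m" "m \<le> 1" "0 < \<kappa> * m" "\<kappa> * m \<le> 1"
    using s by (auto simp: m_def \<kappa>_def min_def)
  have W0: "\<And>x. 0 \<le> W x" "AE x in lebesgue. 0 < W x"
    using W unfolding in_Ap_def weight_def by auto
  have VG: "V = (\<lambda>x. W x powr a * exp (U x) powr c)" by (simp add: V_def exp_powr_real mult.commute)
  have VG': "V x powr (1 - conj_exp s) = (W x powr (1 - conj_exp s)) powr a * exp (- \<kappa> * U x) powr c" for x
    using W0(1)[of x] unfolding V_def \<kappa>(2)
    by (simp add: powr_mult powr_powr exp_powr_real mult_ac)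
  have main: "set_integrable lebesgue Q V \<and> set_integrable lebesgue Q (\<lambda>x. V x powr (1 - conj_exp s))
      \<and> avg Q V * avg Q (\<lambda>x. V x powr (1 - conj_exp s)) powr (s - 1) \<le> 4 powr (m * c) * Ap_const s W powr a"
    if Q: "Q \<in> cubes" for Q
  proof -
    obtain u X where X: "set_integrable lebesgue Q (\<lambda>x. exp (X x))" "avg Q (\<lambda>x. exp (X x)) \<le> 2"
      and uX: "\<And>x. \<bar>U x - u\<bar> \<le> m * X x"
      using osc[OF Q] unfolding m_def by blast
    have 1: "U x \<le> u + m * X x" for x using uX[of x] by linarith
    have 2: "- \<kappa> * U x \<le> - \<kappa> * u + (\<kappa> * m) * X x" for x
    proof -
      have "\<kappa> * (u - U x) \<le> \<kappa> * (m * X x)" using uX[of x] \<kappa>(1) by (intro mult_left_mono) auto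
      then show ?thesis by (simp add: algebra_simps)
    qed
    note E1 = avg_exp_le[OF Q U X m(1,2) 1] 
    note I = in_Ap_cubeD[OF W Q]
    have U': "(\<lambda>x. - \<kappa> * U x) \<in> borel_measurable lebesgue" by measurable
    note H1 = avg_Holder[OF Q I(1) W0(1) E1(1) _ ac, folded VG]
    note H2 = avg_Holder[OF Q I(2) _ avg_exp_le(1)[OF Q U' X m(3,4) 2] _ ac, folded VG']
    define A B where "A = avg Q W" and "B = avg Q (\<lambda>x. W x powr (1 - conj_exp s))"
    have AB: "0 \<le> A" "0 \<le> B" unfolding A_def B_def using W0(1) by (auto intro: avg_nonneg)
    have V1: "avg Q V \<le> A powr a * (exp u * 2 powr m) powr c"
    proof -
      have "avg Q V \<le> A powr a * avg Q (\<lambda>x. exp (U x)) powr c" using H1(2) by (simp add: A_def)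
      also have "\<dots> \<le> A powr a * (exp u * 2 powr m) powr c"
        using E1(2) ac by (intro mult_left_mono powr_mono2 avg_nonneg) auto
      finally show ?thesis .
    qed
    have V2: "avg Q (\<lambda>x. V x powr (1 - conj_exp s)) \<le> B powr a * (exp (- \<kappa> * u) * 2 powr (\<kappa> * m)) powr c"
    proof -
      have "avg Q (\<lambda>x. V x powr (1 - conj_exp s)) \<le> B powr a * avg Q (\<lambda>x. exp (- \<kappa> * U x)) powr c"
        using H2(2) by (simp add: B_def)
      also have "\<dots> \<le> B powr a * (exp (- \<kappa> * u) * 2 powr (\<kappa> * m)) powr c"
        using avg_exp_le(2)[OF Q U' X m(3,4) 2] ac
        by (intro mult_left_mono powr_mono2 avg_nonneg) auto
      finally show ?thesis .
    qed
    have "avg Q (\<lambda>x. V x powr (1 - conj_exp s)) powr (s - 1)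
        \<le> (B powr a * (exp (- \<kappa> * u) * 2 powr (\<kappa> * m)) powr c) powr (s - 1)"
      using V2 s by (intro powr_mono2 avg_nonneg) auto
    \<comment> \<open>Because \<open>\<kappa> * (s - 1) = 1\<close>, the outer power restores the
      exponent \<open>m\<close>: the second average contributes the same \<open>2 powr m\<close> as
      the first, with the opposite sign of \<open>u\<close>.\<close>
    also have "\<dots> = B powr (a * (s - 1)) * (exp (- u) * 2 powr m) powr c"
    proof -
      define P where "P = exp (- u) * 2 powr m"
      have "exp (- \<kappa> * u) * 2 powr (\<kappa> * m) = P powr \<kappa>"
        by (simp add: P_def powr_mult powr_powr exp_powr_real mult.commute)
      moreover have "\<kappa> * c * (s - 1) = c" using \<kappa>(3) by (simp add: mult.assoc mult.left_commute)
      ultimately show ?thesis unfolding P_def[symmetric] by (simp only: powr_mult powr_powr)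
    qed
    finally have V2': "avg Q (\<lambda>x. V x powr (1 - conj_exp s)) powr (s - 1)
      \<le> B powr (a * (s - 1)) * (exp (- u) * 2 powr m) powr c" .
    have "avg Q V * avg Q (\<lambda>x. V x powr (1 - conj_exp s)) powr (s - 1)
      \<le> (A powr a * (exp u * 2 powr m) powr c) * (B powr (a * (s - 1)) * (exp (- u) * 2 powr m) powr c)"
      by (intro mult_mono V1 V2') auto
    also have "\<dots> = (A * B powr (s - 1)) powr a * ((exp u * exp (- u)) * (2 powr m * 2 powr m)) powr c"
      using AB by (simp add: powr_mult powr_powr mult_ac)
    also have "\<dots> = (A * B powr (s - 1)) powr a * 4 powr (m * c)"
      by (simp add: exp_minus_inverse powr_powr flip: powr_mult)
    also have "\<dots> \<le> Ap_const s W powr a * 4 powr (m * c)"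
      using I(3) AB ac unfolding A_def B_def by (intro mult_right_mono powr_mono2) auto
    finally have "avg Q V * avg Q (\<lambda>x. V x powr (1 - conj_exp s)) powr (s - 1)
      \<le> 4 powr (m * c) * Ap_const s W powr a" by (simp add: mult.commute)
    then show ?thesis using H1(1) H2(1) by simp
  qed
  show "Ap_const s (\<lambda>x. W x powr a * exp (c * U x)) \<le> 4 powr (min 1 (s - 1) * c) * Ap_const s W powr a"
    unfolding V_def[symmetric] m_def[symmetric] by (rule Ap_products_boundI(2)) (use main in blast)
  have "bdd_above (Ap_products s V)" 
    by (rule Ap_products_boundI(1)) (use main in blast)
  moreover have "AE x in lebesgue. 0 < V x" using W0(2) by (auto simp: V_def)
  ultimately show "in_Ap s (\<lambda>x. W x powr a * exp (c * U x))"
    using main unfolding V_def in_Ap_def weight_def locally_integrable_iff_cubes by auto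
qed

text \<open>\<open>Ap_exp_perturbation\<close> with exponents \<open>1 / \<eta>\<close> and
  \<open>1 / \<eta>'\<close>. The factor \<open>\<eta>' * \<theta>\<close> in \<open>U\<close> makes
  \<open>exp (U / \<eta>')\<close> equal to \<open>exp (\<theta> Re (z b))\<close>, and the radius
  allowed for \<open>z\<close> makes the oscillation of \<open>U\<close> about its value at the mean
  of \<open>b\<close> at most \<open>min 1 (s - 1)\<close> times
  \<open>|b - avg Q b| / \<beta>\<close>.\<close>

lemma Ap_BMO_exponential:
  fixes b :: "real^'n \<Rightarrow> complex"
  assumes w: "weight w" and Ap: "in_Ap s (\<lambda>x. w x powr (\<theta> * \<eta>))" and s: "1 < s" and \<theta>: "0 < \<theta>"
    and \<eta>: "1 < \<eta>" "1 / \<eta> + 1 / \<eta>' = 1"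
    and b: "b \<in> BMO" "BMO_norm b < ennreal \<beta>" "0 < \<beta>"
    and z: "cmod z \<le> min 1 (s - 1) / (\<eta>' * \<theta> * \<beta>)"
  shows "in_Ap s (\<lambda>x. (w x * exp (Re (z * b x))) powr \<theta>)"
    and "Ap_const s (\<lambda>x. (w x * exp (Re (z * b x))) powr \<theta>)
      \<le> 4 powr (min 1 (s - 1) / \<eta>') * Ap_const s (\<lambda>x. w x powr (\<theta> * \<eta>)) powr (1 / \<eta>)"
proof -
  have \<eta>': "0 < \<eta>'"
  proof -
    have "1 / \<eta>' = 1 - 1 / \<eta>" using \<eta>(2) by simp
    also have "\<dots> > 0" using \<eta>(1) by simp
    finally show ?thesis by simp
  qed
  have [measurable]: "b \<in> borel_measurable lebesgue"
    using b(1) unfolding BMO_def by (auto intro: locally_integrable_borel_measurable)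
  have w0: "\<And>x. 0 \<le> w x" using w by (simp add: weight_def)
  define U where "U = (\<lambda>x. \<eta>' * \<theta> * Re (z * b x))"
  have U: "U \<in> borel_measurable lebesgue" unfolding U_def by measurable
  have osc: "\<exists>u X. set_integrable lebesgue Q (\<lambda>x. exp (X x))
      \<and> avg Q (\<lambda>x. exp (X x)) \<le> 2 \<and> (\<forall>x. \<bar>U x - u\<bar> \<le> min 1 (s - 1) * X x)" if Q: "Q \<in> cubes" for Q
  proof (intro exI conjI allI)
    show "set_integrable lebesgue Q (\<lambda>x. exp (cmod (b x - avg Q b) / \<beta>))"
      "avg Q (\<lambda>x. exp (cmod (b x - avg Q b) / \<beta>)) \<le> 2"
      by (rule BMO_exp_avg_le[OF b Q])+
    fix x
    have "U x - \<eta>' * \<theta> * Re (z * avg Q b) = \<eta>' * \<theta> * Re (z * (b x - avg Q b))"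
      by (simp add: U_def algebra_simps)
    then have "\<bar>U x - \<eta>' * \<theta> * Re (z * avg Q b)\<bar> = \<eta>' * \<theta> * \<bar>Re (z * (b x - avg Q b))\<bar>"
      using \<eta>' \<theta> by (simp add: abs_mult)
    also have "\<dots> \<le> \<eta>' * \<theta> * (cmod z * cmod (b x - avg Q b))"
      using \<eta>' \<theta> abs_Re_le_cmod[of "z * (b x - avg Q b)"] by (intro mult_left_mono) (auto simp: norm_mult)
    also have "\<dots> \<le> \<eta>' * \<theta> * (min 1 (s - 1) / (\<eta>' * \<theta> * \<beta>) * cmod (b x - avg Q b))"
      using \<eta>' \<theta> z by (intro mult_left_mono mult_right_mono) auto
    also have "\<dots> = min 1 (s - 1) * (cmod (b x - avg Q b) / \<beta>)"
      using \<eta>' \<theta> by simp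
    finally show "\<bar>U x - \<eta>' * \<theta> * Re (z * avg Q b)\<bar> \<le> min 1 (s - 1) * (cmod (b x - avg Q b) / \<beta>)" .
  qed
  have eq: "(w x powr (\<theta> * \<eta>)) powr (1 / \<eta>) * exp (1 / \<eta>' * U x) = (w x * exp (Re (z * b x))) powr \<theta>" for x
    using w0[of x] \<eta>(1) \<eta>' by (simp add: powr_powr powr_mult U_def exp_powr_real mult.commute)
  have ac: "0 < 1 / \<eta>" "0 < 1 / \<eta>'" using \<eta>(1) \<eta>' by auto
  note P = Ap_exp_perturbation[OF Ap s ac \<eta>(2) U osc, unfolded eq]
  show "in_Ap s (\<lambda>x. (w x * exp (Re (z * b x))) powr \<theta>)" by (rule P(1))
  show "Ap_const s (\<lambda>x. (w x * exp (Re (z * b x))) powr \<theta>)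
      \<le> 4 powr (min 1 (s - 1) / \<eta>') * Ap_const s (\<lambda>x. w x powr (\<theta> * \<eta>)) powr (1 / \<eta>)"
    using P(2) by simp
qed

section \<open>Weighted norm bounds\<close>

lemma Lp_norm_le_iff:
  assumes "0 < p" "0 \<le> C"
  shows "Lp_norm p v f \<le> ennreal C
    \<longleftrightarrow> (\<integral>\<^sup>+ x. ennreal (cmod (f x) powr p * v x) \<partial>lebesgue) \<le> ennreal (C powr p)"
proof -
  let ?I = "\<integral>\<^sup>+ x. ennreal (cmod (f x) powr p * v x) \<partial>lebesgue"
  show ?thesis
  proof (cases ?I)
    case top
    then show ?thesis by (simp add: Lp_norm_def ennreal_powr_def top_unique)
  next
    case (real r)
    have "r powr (1 / p) \<le> C \<longleftrightarrow> r \<le> C powr p"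
    proof
      assume "r powr (1 / p) \<le> C"
      then have "(r powr (1 / p)) powr p \<le> C powr p" using assms by (intro powr_mono2) auto
      then show "r \<le> C powr p" using assms real by (simp add: powr_powr)
    next
      assume "r \<le> C powr p"
      then have "r powr (1 / p) \<le> (C powr p) powr (1 / p)" using assms real by (intro powr_mono2) auto
      then show "r powr (1 / p) \<le> C" using assms by (simp add: powr_powr)
    qed
    then show ?thesis using real assms by (simp add: Lp_norm_def ennreal_powr_def)
  qed
qed

lemma Lp_spaceE:
  assumes "f \<in> Lp_space p v"
  obtains C where "0 \<le> C" "Lp_norm p v f = ennreal C" "f \<in> borel_measurable lebesgue"
proof -
  have "f \<in> borel_measurable lebesgue" "Lp_norm p v f < top" using assms by (auto simp: Lp_space_def)
  then show ?thesis using that by (cases "Lp_norm p v f") auto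
qed

text \<open>Fatou's lemma, run on the measurable majorants \<open>U n\<close> only. The limit
  \<open>u\<close> and the approximants \<open>l n\<close> may be non-measurable, which matters for
  norms of the vector-valued \<open>S g\<close>. The bound is asked for \<open>n > 0\<close> because
  it will be applied to means over \<open>n\<close> points.\<close>

lemma nn_integral_dominated_limit_le:
  fixes u :: "'a \<Rightarrow> ennreal"
  assumes [measurable]: "\<And>n. U n \<in> borel_measurable M"
    and lim: "AE x in M. (\<lambda>n. l n x) \<longlonglongrightarrow> u x" and dom: "AE x in M. \<forall>n. l n x \<le> U n x"
    and le: "\<And>n::nat. n > 0 \<Longrightarrow> integral\<^sup>N M (U n) \<le> C"
  shows "integral\<^sup>N M u \<le> C"
proof -
  have "integral\<^sup>N M u \<le> (\<integral>\<^sup>+x. liminf (\<lambda>n. U n x) \<partial>M)"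
  proof (rule nn_integral_mono_AE)
    show "AE x in M. u x \<le> liminf (\<lambda>n. U n x)"
      using lim dom
    proof eventually_elim
      case (elim x)
      have "u x = liminf (\<lambda>n. l n x)" using elim(1) by (simp add: lim_imp_Liminf)
      also have "\<dots> \<le> liminf (\<lambda>n. U n x)" using elim(2) by (intro Liminf_mono) auto
      finally show ?case .
    qed
  qed
  also have "\<dots> \<le> liminf (\<lambda>n. integral\<^sup>N M (U n))" by (rule nn_integral_liminf) measurable
  also have "\<dots> \<le> limsup (\<lambda>n. integral\<^sup>N M (U n))" by (rule Liminf_le_Limsup) simp
  also have "\<dots> \<le> C"
    by (rule Limsup_bounded) (rule eventually_mono[OF eventually_gt_at_top[of 0] le])
  finally show ?thesis .
qed

text \<open>
  The hypothesis of the theorem only covers locally integrable weights, and for \<open>\<theta> < 1\<close> local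
  integrability of \<open>v powr \<theta>\<close> does not give that of \<open>v\<close>.  It extends to such \<open>v\<close> because the
  bounded weights \<open>min v n\<close> have no larger Muckenhoupt constant.
\<close>
lemma weighted_bound_extends:
  fixes v :: "real^'n \<Rightarrow> real"
  assumes hyp: "\<And>w f. weight w \<Longrightarrow> in_Ap s (\<lambda>x. w x powr \<theta>) \<Longrightarrow> f \<in> Lp_space p (\<lambda>x. w x powr p) \<Longrightarrow>
      f \<in> D \<and> Lp_norm q (\<lambda>x. w x powr q) (T f)
        \<le> ennreal (\<phi> (Ap_const s (\<lambda>x. w x powr \<theta>))) * Lp_norm p (\<lambda>x. w x powr p) f"
    and Tm: "\<And>f. f \<in> D \<Longrightarrow> T f \<in> borel_measurable lebesgue"
    and pq: "1 \<le> p" "1 \<le> q" and \<theta>: "0 < \<theta>" and s: "1 < s"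
    and \<phi>: "mono_on {1..} \<phi>" "\<And>t. 1 \<le> t \<Longrightarrow> 0 \<le> \<phi> t"
    and v: "\<And>x. 0 \<le> v x" "in_Ap s (\<lambda>x. v x powr \<theta>)" and K: "Ap_const s (\<lambda>x. v x powr \<theta>) \<le> K"
    and g: "g \<in> borel_measurable lebesgue" and C: "0 \<le> C"
      "(\<integral>\<^sup>+ x. ennreal (cmod (g x) powr p * v x powr p) \<partial>lebesgue) \<le> ennreal (C powr p)"
  shows "g \<in> D"
    and "(\<integral>\<^sup>+ x. ennreal (cmod (T g x) powr q * v x powr q) \<partial>lebesgue) \<le> ennreal ((\<phi> K * C) powr q)"
proof -
  define u where "u n x = min (v x) (real (Suc n))" for n x
  have "(\<lambda>x. v x powr \<theta>) \<in> borel_measurable lebesgue"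
    using v(2) unfolding in_Ap_def weight_def by (auto intro: locally_integrable_borel_measurable)
  \<comment> \<open>Only \<open>v powr \<theta>\<close> is known to be locally integrable, so the
    measurability of \<open>v\<close> is recovered from it.\<close>
  then have "(\<lambda>x. (v x powr \<theta>) powr (1 / \<theta>)) \<in> borel_measurable lebesgue" by measurable
  moreover have "(v x powr \<theta>) powr (1 / \<theta>) = v x" for x using v(1) \<theta> by (simp add: powr_powr)
  ultimately have [measurable]: "v \<in> borel_measurable lebesgue" by simp
  have [measurable]: "u n \<in> borel_measurable lebesgue" for n unfolding u_def by measurable
  have u0: "0 \<le> u n x" "u n x \<le> v x" for n x using v(1) by (auto simp: u_def)
  have wu: "weight (u n)" for n
    unfolding weight_def locally_integrable_iff_cubes
  proof (intro conjI allI ballI u0)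
    fix Q :: "(real^'n) set" assume Q: "Q \<in> cubes"
    show "set_integrable lebesgue Q (u n)"
      by (rule set_integrable_dominated[OF set_integrable_const_cube[OF Q, of "real (Suc n)"] _ cubes_sets[OF Q]])
         (use v(1) in \<open>auto simp: u_def abs_le_iff intro: order_trans[OF _ v(1)]\<close>)
  qed
  \<comment> \<open>Truncating \<open>v\<close> truncates its power at the corresponding level, so
    \<open>in_Ap_truncate\<close> applies.\<close>
  have eq: "(\<lambda>x. u n x powr \<theta>) = (\<lambda>x. min (v x powr \<theta>) (real (Suc n) powr \<theta>))" for n
    using v(1) \<theta> by (intro ext) (auto simp: u_def min_def intro!: powr_mono2 antisym)
  have Au: "in_Ap s (\<lambda>x. u n x powr \<theta>)" "Ap_const s (\<lambda>x. u n x powr \<theta>) \<le> Ap_const s (\<lambda>x. v x powr \<theta>)" for n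
    unfolding eq using in_Ap_truncate[OF v(2) s, of "real (Suc n) powr \<theta>"] by auto
  have K1: "1 \<le> K" using Ap_const_ge_1[OF v(2) s] K by linarith
  have \<phi>K: "\<phi> (Ap_const s (\<lambda>x. u n x powr \<theta>)) \<le> \<phi> K" for n
    using Ap_const_ge_1[OF Au(1) s] Au(2) K K1 by (intro mono_onD[OF \<phi>(1)]) (auto intro: order_trans)
  have gu: "(\<integral>\<^sup>+ x. ennreal (cmod (g x) powr p * u n x powr p) \<partial>lebesgue) \<le> ennreal (C powr p)" for n
    by (rule order_trans[OF nn_integral_mono C(2)])
       (use u0 pq in \<open>auto intro!: ennreal_leI mult_left_mono powr_mono2\<close>)
  then have gu': "Lp_norm p (\<lambda>x. u n x powr p) g \<le> ennreal C" for n
    using Lp_norm_le_iff[of p C "\<lambda>x. u n x powr p" g] pq C by simp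
  have gL: "g \<in> Lp_space p (\<lambda>x. u n x powr p)" for n
    using g gu'[of n] by (auto simp: Lp_space_def intro: order_le_less_trans)
  note H = hyp[OF wu Au(1) gL]
  show gD: "g \<in> D" using H by blast
  note [measurable] = Tm[OF gD]
  have bound: "(\<integral>\<^sup>+ x. ennreal (cmod (T g x) powr q * u n x powr q) \<partial>lebesgue) \<le> ennreal ((\<phi> K * C) powr q)" for n
  proof -
    have "Lp_norm q (\<lambda>x. u n x powr q) (T g)
        \<le> ennreal (\<phi> (Ap_const s (\<lambda>x. u n x powr \<theta>))) * Lp_norm p (\<lambda>x. u n x powr p) g"
      using H by blast
    also have "\<dots> \<le> ennreal (\<phi> K) * ennreal C" by (intro mult_mono gu' ennreal_leI \<phi>K) auto
    also have "\<dots> = ennreal (\<phi> K * C)" using \<phi>(2)[OF K1] C by (simp add: ennreal_mult)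
    finally show ?thesis
      using Lp_norm_le_iff[of q "\<phi> K * C" "\<lambda>x. u n x powr q" "T g"] pq \<phi>(2)[OF K1] C by simp
  qed
  show "(\<integral>\<^sup>+ x. ennreal (cmod (T g x) powr q * v x powr q) \<partial>lebesgue) \<le> ennreal ((\<phi> K * C) powr q)"
  \<comment> \<open>At each point the truncation is inactive from some \<open>n\<close> on; here the
    approximants are their own majorants.\<close>
  proof (rule nn_integral_dominated_limit_le[where U = "\<lambda>n x. ennreal (cmod (T g x) powr q * u n x powr q)"
        and l = "\<lambda>n x. ennreal (cmod (T g x) powr q * u n x powr q)"])
    show "AE x in lebesgue. (\<lambda>n. ennreal (cmod (T g x) powr q * u n x powr q))
        \<longlonglongrightarrow> ennreal (cmod (T g x) powr q * v x powr q)"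
    proof (rule AE_I2)
      fix x
      have "eventually (\<lambda>n. u n x = v x) sequentially"
        using eventually_ge_at_top[of "nat \<lceil>v x\<rceil>"]
      proof eventually_elim
        case (elim n)
        then have "v x \<le> real n" by (simp add: nat_ceiling_le_eq)
        then show ?case by (simp add: u_def)
      qed
      then show "(\<lambda>n. ennreal (cmod (T g x) powr q * u n x powr q))
          \<longlonglongrightarrow> ennreal (cmod (T g x) powr q * v x powr q)"
        by (intro tendsto_eventually) (erule eventually_mono, simp)
    qed
  qed (use bound in auto)
qed

text \<open>The decay rate is split as \<open>lam = \<mu> * \<mu>\<close>. One factor \<mu> makes
  the integrals of the \<open>q\<close>-th powers of \<open>u m / \<mu> ^ m\<close> summable; hence
  at almost every point these powers tend to zero, and eventually
  \<open>u m x \<le> \<mu> ^ m\<close> with the other factor.\<close>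

lemma AE_summable_if_geometric:
  fixes u :: "nat \<Rightarrow> 'a \<Rightarrow> real" and v :: "'a \<Rightarrow> real"
  assumes [measurable]: "\<And>m. u m \<in> borel_measurable M" "v \<in> borel_measurable M"
    and u: "\<And>m x. 0 \<le> u m x" and v: "\<And>x. 0 \<le> v x" "AE x in M. 0 < v x"
    and q: "0 < q" and K: "0 \<le> K" and lam: "0 < lam" "lam < 1"
    and le: "\<And>m. (\<integral>\<^sup>+x. ennreal (u m x powr q * v x) \<partial>M) \<le> ennreal ((K * lam ^ m) powr q)"
  shows "AE x in M. summable (\<lambda>m. u m x)"
proof -
  define \<mu> where "\<mu> = sqrt lam"
  have \<mu>: "0 < \<mu>" "\<mu> < 1" "\<mu> * \<mu> = lam" using lam by (auto simp: \<mu>_def)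
  define h where "h m = (\<lambda>x. ennreal ((u m x / \<mu> ^ m) powr q * v x))" for m
  have [measurable]: "h m \<in> borel_measurable M" for m unfolding h_def by measurable
  have int: "integral\<^sup>N M (h m) \<le> ennreal (K powr q * (\<mu> powr q) ^ m)" for m
  proof -
    have "h m = (\<lambda>x. ennreal (1 / (\<mu> ^ m) powr q) * ennreal (u m x powr q * v x))"
      unfolding h_def using u v \<mu> by (simp add: powr_divide flip: ennreal_mult)
    then have "integral\<^sup>N M (h m) = ennreal (1 / (\<mu> ^ m) powr q) * (\<integral>\<^sup>+x. ennreal (u m x powr q * v x) \<partial>M)"
      by (simp add: nn_integral_cmult)
    also have "\<dots> \<le> ennreal (1 / (\<mu> ^ m) powr q) * ennreal ((K * lam ^ m) powr q)"
      by (intro mult_left_mono le) auto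
    also have "\<dots> = ennreal (1 / (\<mu> ^ m) powr q * (K * lam ^ m) powr q)"
      by (simp flip: ennreal_mult)
    also have "1 / (\<mu> ^ m) powr q * (K * lam ^ m) powr q = ((K * lam ^ m) / \<mu> ^ m) powr q"
      using K lam \<mu> by (simp add: powr_divide)
    also have "(K * lam ^ m) / \<mu> ^ m = K * \<mu> ^ m"
      using \<mu>(1) unfolding \<mu>(3)[symmetric] by (simp add: power_mult_distrib)
    also have "(K * \<mu> ^ m) powr q = K powr q * (\<mu> powr q) ^ m"
      using K \<mu> by (simp add: powr_mult powr_powr powr_power mult.commute flip: powr_realpow)
    finally show ?thesis .
  qed
  have \<mu>q: "0 < \<mu> powr q" "\<mu> powr q < 1" using \<mu> q powr_less_mono2[of q \<mu> 1] by auto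
  have "(\<integral>\<^sup>+x. (\<Sum>m. h m x) \<partial>M) = (\<Sum>m. integral\<^sup>N M (h m))"
    by (rule nn_integral_suminf) measurable
  also have "\<dots> \<le> (\<Sum>m. ennreal (K powr q * (\<mu> powr q) ^ m))"
    by (intro suminf_le int) auto
  also have "\<dots> < \<infinity>"
  proof -
    have "(\<Sum>m. ennreal (K powr q * (\<mu> powr q) ^ m)) = ennreal (\<Sum>m. K powr q * (\<mu> powr q) ^ m)"
      using \<mu>q by (intro suminf_ennreal2) (auto intro!: summable_mult summable_geometric)
    then show ?thesis by simp
  qed
  finally have "(\<integral>\<^sup>+x. (\<Sum>m. h m x) \<partial>M) \<noteq> \<infinity>" by simp
  then have "AE x in M. (\<Sum>m. h m x) \<noteq> \<infinity>" by (intro nn_integral_PInf_AE) measurable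
  then show ?thesis using v(2)
  proof eventually_elim
    case (elim x)
    have "summable (\<lambda>m. (u m x / \<mu> ^ m) powr q * v x)"
      using elim(1) u v \<mu> unfolding h_def by (intro summable_suminf_not_top) auto
    then have "(\<lambda>m. (u m x / \<mu> ^ m) powr q * v x) \<longlonglongrightarrow> 0" by (rule summable_LIMSEQ_zero)
    \<comment> \<open>The positive threshold \<open>v x\<close> cancels the weight and leaves a
      \<open>q\<close>-th power below 1.\<close>
    then have "eventually (\<lambda>m. (u m x / \<mu> ^ m) powr q * v x < v x) sequentially"
      by (rule order_tendstoD(2)) (rule elim(2))
    then have "eventually (\<lambda>m. norm (u m x) \<le> \<mu> ^ m) sequentially"
    proof eventually_elim
      case (elim m)
      then have "(u m x / \<mu> ^ m) powr q < 1" using \<open>0 < v x\<close> by simp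
      then have "u m x / \<mu> ^ m < 1"
        using q powr_mono2[of q 1 "u m x / \<mu> ^ m"] by (smt (verit) powr_one_eq_one)
      then show ?case using \<mu> u[of m x] by (simp add: field_simps)
    qed
    then show ?case
      by (rule summable_comparison_test_ev) (use \<mu> in \<open>auto intro: summable_geometric\<close>)
  qed
qed

text \<open>By compactness finitely many balls of radius \<open>1 - \<delta>\<close> cover the unit
  circle, and one centre is close to the direction that rotates \<open>c\<close> onto its modulus.
  With \<open>\<delta> = \<rho> / r\<close> this trades \<open>exp (\<rho> |b|)\<close> for finitely
  many \<open>exp (r Re (\<omega> b))\<close>.\<close>

lemma finite_directions:
  assumes "\<delta> < (1::real)"
  obtains W :: "complex set" where "finite W" "\<And>\<omega>. \<omega> \<in> W \<Longrightarrow> cmod \<omega> \<le> 1"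
    "\<And>c. \<exists>\<omega>\<in>W. \<delta> * cmod c \<le> Re (\<omega> * c)"
proof -
  obtain W where W: "W \<subseteq> sphere (0::complex) 1" "finite W" "sphere 0 1 \<subseteq> (\<Union>\<omega>\<in>W. ball \<omega> (1 - \<delta>))"
    using compactE_image[OF compact_sphere[of "0::complex" 1], of "sphere 0 1" "\<lambda>\<omega>. ball \<omega> (1 - \<delta>)"] assms
    by (metis (no_types, lifting) UN_iff centre_in_ball diff_gt_0_iff_gt open_ball subsetI)
  have "\<exists>\<omega>\<in>W. \<delta> * cmod c \<le> Re (\<omega> * c)" for c
  proof -
    define u where "u = (if c = 0 then 1 else cnj c / complex_of_real (cmod c))"
    have u: "cmod u = 1" "u * c = complex_of_real (cmod c)"
      using complex_norm_square[of c]
      by (auto simp: u_def norm_divide field_simps power2_eq_square)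
    then obtain \<omega> where \<omega>: "\<omega> \<in> W" "cmod (\<omega> - u) < 1 - \<delta>"
      using W(3) by (force simp: dist_norm subset_iff)
    have "cmod c - Re (\<omega> * c) = Re ((u - \<omega>) * c)" using u by (simp add: left_diff_distrib)
    also have "\<dots> \<le> cmod (\<omega> - u) * cmod c"
      using complex_Re_le_cmod[of "(u - \<omega>) * c"] by (simp add: norm_mult norm_minus_commute)
    also have "\<dots> \<le> (1 - \<delta>) * cmod c" using \<omega> by (intro mult_right_mono) auto
    finally show ?thesis using \<omega>(1) by (auto simp: algebra_simps)
  qed
  with W show ?thesis by (intro that[of W]) auto
qed

section \<open>Means over circles\<close>

lemma bounded_linear_scaleC_right: "bounded_linear (\<lambda>x :: 'b::complex_banach. a *\<^sub>C x)"
proof (rule bounded_linear_intro)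
  show "a *\<^sub>C (r *\<^sub>R x) = r *\<^sub>R (a *\<^sub>C x)" for r and x :: 'b
    by (metis scaleC_of_real scaleC_scaleC mult.commute)
  show "norm (a *\<^sub>C x) \<le> norm x * cmod a" for x :: 'b
    by (simp add: norm_scaleC)
qed (rule scaleC_add_right)

lemma bounded_linear_scaleC_left: "bounded_linear (\<lambda>a. a *\<^sub>C (x :: 'b::complex_banach))"
proof (rule bounded_linear_intro)
  show "(r *\<^sub>R a) *\<^sub>C x = r *\<^sub>R (a *\<^sub>C x)" for r a
    by (metis scaleC_of_real scaleC_scaleC scaleR_conv_of_real)
  show "norm (a *\<^sub>C x) \<le> cmod a * norm x" for a
    by (simp add: norm_scaleC)
qed (rule scaleC_add_left)

lemmas scaleC_sum_right = linear_sum[OF bounded_linear.linear[OF bounded_linear_scaleC_right]]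
lemmas scaleC_sum_left = linear_sum[OF bounded_linear.linear[OF bounded_linear_scaleC_left]]
lemmas scaleC_zero_left = linear_0[OF bounded_linear.linear[OF bounded_linear_scaleC_left]]
lemmas scaleC_minus_left = linear_neg[OF bounded_linear.linear[OF bounded_linear_scaleC_left]]
lemmas scaleC_diff_left = linear_diff[OF bounded_linear.linear[OF bounded_linear_scaleC_left]]

lemma scaleC_one: "1 *\<^sub>C x = (x :: 'b::complex_banach)"
  using scaleC_of_real[of 1 x] by simp

text \<open>Multiplying by \<open>b\<close> before and after \<open>S\<close> are commuting
  operations, so their iterated difference expands by the binomial theorem as an exact pointwise
  identity. The induction varies \<open>f\<close> because the step also uses the formula for
  \<open>b f\<close>.\<close>

lemma iter_commutator_eq_sum:
  fixes S :: "(real^'n \<Rightarrow> complex) \<Rightarrow> real^'n \<Rightarrow> 'b::complex_banach"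
  shows "iter_commutator k S b f x =
    (\<Sum>m\<le>k. (of_nat (k choose m) * (- b x) ^ (k - m)) *\<^sub>C S (\<lambda>y. b y ^ m * f y) x)"
proof (induction k arbitrary: f)
  case 0
  then show ?case by (simp add: scaleC_one)
next
  case (Suc k)
  define h where "h m = S (\<lambda>y. b y ^ m * f y) x" for m
  have h: "S (\<lambda>y. b y ^ m * (b y * f y)) x = h (Suc m)" for m
    by (simp add: h_def mult.assoc mult.left_commute)
  let ?c = "\<lambda>m. of_nat (k choose m) * (- b x) ^ (Suc k - m) :: complex"
  have "iter_commutator (Suc k) S b f x =
      (\<Sum>m\<le>k. (of_nat (k choose m) * (- b x) ^ (k - m)) *\<^sub>C h (Suc m))
      + (- b x) *\<^sub>C (\<Sum>m\<le>k. (of_nat (k choose m) * (- b x) ^ (k - m)) *\<^sub>C h m)"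
    by (simp add: commutator_def Suc.IH h scaleC_minus_left h_def[symmetric])
  also have "(- b x) *\<^sub>C (\<Sum>m\<le>k. (of_nat (k choose m) * (- b x) ^ (k - m)) *\<^sub>C h m)
      = (\<Sum>m\<le>k. ?c m *\<^sub>C h m)"
    unfolding scaleC_sum_right scaleC_scaleC
    by (intro sum.cong refl arg_cong2[where f = scaleC]) (simp add: Suc_diff_le)
  \<comment> \<open>The added term vanishes since \<open>k choose Suc k = 0\<close>; it aligns the
    two sums for Pascal's rule after the shift.\<close>
  also have "\<dots> = (\<Sum>m\<le>Suc k. ?c m *\<^sub>C h m)" by (simp add: binomial_eq_0 scaleC_zero_left)
  also have "\<dots> = ?c 0 *\<^sub>C h 0 + (\<Sum>m\<le>k. ?c (Suc m) *\<^sub>C h (Suc m))"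
    by (rule sum.atMost_Suc_shift)
  also have "(\<Sum>m\<le>k. (of_nat (k choose m) * (- b x) ^ (k - m)) *\<^sub>C h (Suc m)) + \<dots>
      = ?c 0 *\<^sub>C h 0 + (\<Sum>m\<le>k. (of_nat (Suc k choose Suc m) * (- b x) ^ (Suc k - Suc m)) *\<^sub>C h (Suc m))"
    by (simp add: sum.distrib distrib_right scaleC_add_left)
  also have "\<dots> = (\<Sum>m\<le>Suc k. (of_nat (Suc k choose m) * (- b x) ^ (Suc k - m)) *\<^sub>C h m)"
    by (subst sum.atMost_Suc_shift) simp
  finally show ?case by (simp only: h_def)
qed

text \<open>The \<open>N\<close> equidistant points on the circle of radius \<open>r\<close>,
  written as powers of one root of unity so that sums over \<open>j\<close> are geometric.\<close>

definition circle_point :: "real \<Rightarrow> nat \<Rightarrow> nat \<Rightarrow> complex"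
  where "circle_point r N j = of_real r * exp (2 * of_real pi * \<i> / of_nat N) ^ j"

lemma norm_circle_point: "0 < r \<Longrightarrow> cmod (circle_point r N j) = r"
  by (simp add: circle_point_def norm_mult norm_power)

lemma circle_point_nonzero: "0 < r \<Longrightarrow> circle_point r N j \<noteq> 0"
  by (simp add: circle_point_def)

text \<open>Discrete orthogonality of characters: the ratio \<omega> of the geometric sum is an
  \<open>N\<close>-th root of unity, and \<open>i + k < N\<close> prevents it from being 1 when
  \<open>i\<close> and \<open>k\<close> differ.\<close>

lemma circle_mean_monomial:
  assumes r: "0 < r" and N: "i + k < N"
  shows "(\<Sum>j<N. circle_point r N j ^ i / circle_point r N j ^ k) / of_nat N = of_bool (i = k)"
proof (cases "i = k")
  case True
  have "circle_point r N j ^ k / circle_point r N j ^ k = 1" for j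
    using r by (simp add: circle_point_nonzero)
  then show ?thesis using N unfolding True by (simp only: sum_constant) simp
next
  case False
  define \<zeta> where "\<zeta> = exp (2 * of_real pi * \<i> / of_nat N)"
  have \<zeta>_power: "\<zeta> ^ l = exp (2 * of_real pi * \<i> * of_nat l / of_nat N)" for l
    unfolding \<zeta>_def by (simp flip: exp_of_nat_mult add: mult_ac)
  have \<zeta>0: "\<zeta> \<noteq> 0" by (simp add: \<zeta>_def)
  have \<zeta>1: "\<zeta> ^ l = 1 \<longleftrightarrow> N dvd l" for l
    unfolding \<zeta>_power using complex_root_unity_eq_1[of N l] N by simp
  define \<omega> where "\<omega> = \<zeta> ^ i / \<zeta> ^ k"
  have "\<omega> \<noteq> 1"
  proof
    assume "\<omega> = 1"
    then have "\<zeta> ^ i = \<zeta> ^ k" using \<zeta>0 by (simp add: \<omega>_def)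
    \<comment> \<open>Maximum minus minimum is the absolute difference, safe under truncated
      subtraction.\<close>
    then have "\<zeta> ^ (max i k - min i k) = 1"
      using \<zeta>0 by (simp add: power_diff max_def min_def)
    then have "N dvd max i k - min i k" by (simp add: \<zeta>1)
    then show False using N False by (auto dest!: dvd_imp_le simp: max_def min_def split: if_splits)
  qed
  moreover have "\<omega> ^ N = 1"
  proof -
    have "\<zeta> ^ N = 1" by (simp add: \<zeta>1)
    then show ?thesis using \<zeta>0 by (simp add: \<omega>_def power_divide mult.commute[of _ N] power_mult flip: power_mult[of \<zeta> i N] power_mult[of \<zeta> k N])
  qed
  ultimately have "(\<Sum>j<N. \<omega> ^ j) = 0" by (simp add: geometric_sum)
  moreover have eq: "circle_point r N j ^ i / circle_point r N j ^ k = of_real r ^ i / of_real r ^ k * \<omega> ^ j" for j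
    unfolding circle_point_def \<zeta>_def[symmetric] \<omega>_def
    by (simp add: power_mult_distrib power_divide mult.commute flip: power_mult)
  ultimately show ?thesis using False unfolding eq sum_distrib_left[symmetric] by simp
qed

lemma norm_circle_mean_le:
  assumes "\<And>j. cmod (g j) \<le> B"
  shows "cmod ((\<Sum>j<N. g j) / of_nat N) \<le> B"
proof (cases "N = 0")
  case True
  then show ?thesis using order_trans[OF norm_ge_zero assms[of 0]] by simp
next
  case False
  have "cmod (\<Sum>j<N. g j) \<le> real N * B"
    using sum_norm_le[of "{..<N}" g "\<lambda>_. B"] assms by simp
  then show ?thesis using False by (simp add: norm_divide divide_le_eq mult.commute)
qed

lemma exp_sums_divide: "(\<lambda>n. x ^ n / fact n) sums exp (x :: complex)"
  using exp_converges[of x] by (simp add: scaleR_conv_of_real divide_inverse mult.commute)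

lemma real_exp_sums_divide: "(\<lambda>n. x ^ n / fact n) sums exp (x :: real)"
  using exp_converges[of x] by (simp add: divide_inverse mult.commute)

text \<open>The limit is the coefficient of \<open>z ^ k\<close> in
  \<open>z ^ m * exp (- z * \<beta>)\<close>. Expanding the exponential leaves means of monomials,
  each eventually 0 or 1, and Tannery's theorem with the majorant from
  \<open>exp (|\<beta>| r)\<close> exchanges limit and series.\<close>

lemma circle_mean_exp_tendsto:
  assumes r: "0 < r"
  shows "(\<lambda>N. (\<Sum>j<N. circle_point r N j ^ m * exp (- circle_point r N j * \<beta>) / circle_point r N j ^ k) / of_nat N)
    \<longlonglongrightarrow> (if m \<le> k then (- \<beta>) ^ (k - m) / fact (k - m) else 0)"
proof -
  define \<mu> where "\<mu> N i = (\<Sum>j<N. circle_point r N j ^ i / circle_point r N j ^ k) / of_nat N" for N i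
  have \<mu>_le: "cmod (\<mu> N i) \<le> r ^ i / r ^ k" for N i
    unfolding \<mu>_def by (rule norm_circle_mean_le) (simp add: norm_divide norm_power norm_circle_point r)
  have \<mu>_lim: "(\<lambda>N. \<mu> N i) \<longlonglongrightarrow> of_bool (i = k)" for i
  proof (rule tendsto_eventually)
    show "eventually (\<lambda>N. \<mu> N i = of_bool (i = k)) sequentially"
      using eventually_gt_at_top[of "i + k"]
      by eventually_elim (auto simp: \<mu>_def circle_mean_monomial[OF r])
  qed
  define t where "t l N = (- \<beta>) ^ l / fact l * \<mu> N (l + m)" for l N
  have eq: "(\<Sum>j<N. circle_point r N j ^ m * exp (- circle_point r N j * \<beta>) / circle_point r N j ^ k) / of_nat N
      = (\<Sum>l. t l N)" for N
  proof -
    have 1: "(\<lambda>l. circle_point r N j ^ m * ((- circle_point r N j * \<beta>) ^ l / fact l) / circle_point r N j ^ k)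
      sums (circle_point r N j ^ m * exp (- circle_point r N j * \<beta>) / circle_point r N j ^ k)" for j
      by (intro sums_divide sums_mult exp_sums_divide)
    have "(\<lambda>l. (\<Sum>j<N. circle_point r N j ^ m * ((- circle_point r N j * \<beta>) ^ l / fact l) / circle_point r N j ^ k) / of_nat N)
      sums ((\<Sum>j<N. circle_point r N j ^ m * exp (- circle_point r N j * \<beta>) / circle_point r N j ^ k) / of_nat N)"
      by (intro sums_divide sums_sum 1)
    moreover have "(\<Sum>j<N. circle_point r N j ^ m * ((- circle_point r N j * \<beta>) ^ l / fact l) / circle_point r N j ^ k) / of_nat N
      = t l N" for l
    proof -
      have eq: "circle_point r N j ^ m * ((- circle_point r N j * \<beta>) ^ l / fact l) / circle_point r N j ^ k
        = (- \<beta>) ^ l / fact l * (circle_point r N j ^ (l + m) / circle_point r N j ^ k)" for j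
      proof -
        have "(- circle_point r N j * \<beta>) ^ l = circle_point r N j ^ l * (- \<beta>) ^ l"
          by (simp flip: power_mult_distrib)
        then show ?thesis by (simp add: power_add)
      qed
      show ?thesis unfolding eq t_def \<mu>_def sum_distrib_left[symmetric] by (rule times_divide_eq_right[symmetric])
    qed
    ultimately show ?thesis by (simp add: sums_iff)
  qed
  have "(\<lambda>N. \<Sum>l. t l N) \<longlonglongrightarrow> (\<Sum>l. (- \<beta>) ^ l / fact l * of_bool (l + m = k))"
  proof (rule tannerys_theorem[THEN conjunct2, THEN conjunct2])
    show "(\<lambda>N. t l N) \<longlonglongrightarrow> (- \<beta>) ^ l / fact l * of_bool (l + m = k)" for l
      unfolding t_def by (intro tendsto_intros \<mu>_lim)
    have "cmod (t l N) \<le> (cmod \<beta> * r) ^ l / fact l * (r ^ m / r ^ k)" for l N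
    proof -
      have "cmod (t l N) \<le> cmod \<beta> ^ l / fact l * (r ^ (l + m) / r ^ k)"
        unfolding t_def norm_mult norm_divide norm_power
        using \<mu>_le[of N "l + m"] by (intro mult_mono) auto
      also have "\<dots> = (cmod \<beta> * r) ^ l / fact l * (r ^ m / r ^ k)"
        by (simp add: power_add power_mult_distrib)
      finally show ?thesis .
    qed
    then show "eventually (\<lambda>(l, N). cmod (t l N) \<le> (cmod \<beta> * r) ^ l / fact l * (r ^ m / r ^ k))
        (at_top \<times>\<^sub>F sequentially)" by (intro always_eventually) auto
    show "summable (\<lambda>l. (cmod \<beta> * r) ^ l / fact l * (r ^ m / r ^ k))"
      using real_exp_sums_divide[of "cmod \<beta> * r"] by (intro summable_mult2) (auto simp: sums_iff)
  qed simp
  also have "(\<Sum>l. (- \<beta>) ^ l / fact l * of_bool (l + m = k))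
    = (if m \<le> k then (- \<beta>) ^ (k - m) / fact (k - m) else 0)"
  proof (cases "m \<le> k")
    case True
    then have "(\<Sum>l. (- \<beta>) ^ l / fact l * of_bool (l + m = k))
      = (\<Sum>l\<in>{k - m}. (- \<beta>) ^ l / fact l * of_bool (l + m = k))"
      by (intro suminf_finite) auto
    then show ?thesis using True by simp
  next
    case False
    then have "(\<lambda>l. (- \<beta>) ^ l / fact l * of_bool (l + m = k)) = (\<lambda>_. 0)" by auto
    then show ?thesis using False by simp
  qed
  finally show ?thesis unfolding eq .
qed

text \<open>Cauchy's coefficient formula for \<open>exp (- z * \<beta>)\<close> times the vector
  series with coefficients \<open>a m / fact m\<close>. The \<open>k\<close>-th coefficient carries
  \<open>1 / (m! (k - m)!)\<close>, that is the binomial coefficient divided by \<open>k!\<close>: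
  the binomial form of the iterated commutator.\<close>

lemma conjugated_series_mean_tendsto:
  fixes a :: "nat \<Rightarrow> 'b::complex_banach"
  assumes r: "0 < r" and a: "summable (\<lambda>m. r ^ m / fact m * norm (a m))"
  shows "(\<lambda>N. (\<Sum>j<N. (exp (- circle_point r N j * \<beta>) / circle_point r N j ^ k) *\<^sub>C
        (\<Sum>m. (circle_point r N j ^ m / fact m) *\<^sub>C a m)) /\<^sub>R real N)
    \<longlonglongrightarrow> (\<Sum>m\<le>k. (of_nat (k choose m) * (- \<beta>) ^ (k - m)) *\<^sub>C a m) /\<^sub>R fact k"
    (is "?A \<longlonglongrightarrow> ?L")
proof -
  define \<kappa> where "\<kappa> N m = (\<Sum>j<N. circle_point r N j ^ m * exp (- circle_point r N j * \<beta>)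
    / circle_point r N j ^ k) / of_nat N" for N m
  define \<kappa>' where "\<kappa>' m = (if m \<le> k then (- \<beta>) ^ (k - m) / fact (k - m) else 0)" for m
  have lim: "(\<lambda>N. \<kappa> N m) \<longlonglongrightarrow> \<kappa>' m" for m
    unfolding \<kappa>_def \<kappa>'_def by (rule circle_mean_exp_tendsto[OF r])
  \<comment> \<open>Bounds \<open>exp (- z * \<beta>) / z ^ k\<close> on the circle uniformly in
    \<open>N\<close>, so that the assumed summability is a majorant.\<close>
  define B where "B = exp (r * cmod \<beta>) / r ^ k"
  have B: "0 \<le> B" using r by (simp add: B_def)
  have \<kappa>_le: "cmod (\<kappa> N m) \<le> r ^ m * B" for N m
    unfolding \<kappa>_def
  proof (rule norm_circle_mean_le)
    fix j
    have "cmod (exp (- circle_point r N j * \<beta>)) \<le> exp (r * cmod \<beta>)"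
      using abs_Re_le_cmod[of "circle_point r N j * \<beta>"] r
      by (simp add: norm_mult norm_circle_point abs_le_iff)
    then show "cmod (circle_point r N j ^ m * exp (- circle_point r N j * \<beta>) / circle_point r N j ^ k)
        \<le> r ^ m * B"
      using r by (simp add: norm_mult norm_divide norm_power norm_circle_point B_def divide_right_mono)
  qed
  have \<kappa>'_le: "cmod (\<kappa>' m) \<le> r ^ m * B" for m
    by (rule Lim_norm_ubound[OF _ lim]) (auto simp: \<kappa>_le)
  have summ: "summable (\<lambda>m. (c m / fact m) *\<^sub>C a m)" if "\<And>m. cmod (c m) \<le> r ^ m * K" for c K
  proof (rule summable_norm_cancel, rule summable_comparison_test)
    show "summable (\<lambda>m. K * (r ^ m / fact m * norm (a m)))" by (rule summable_mult[OF a])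
    show "\<exists>N. \<forall>n\<ge>N. norm (norm ((c n / fact n) *\<^sub>C a n)) \<le> K * (r ^ n / fact n * norm (a n))"
    proof (intro exI allI impI)
      fix n
      have "cmod (c n) / fact n * norm (a n) \<le> r ^ n * K / fact n * norm (a n)"
        using that by (intro mult_right_mono divide_right_mono) auto
      then show "norm (norm ((c n / fact n) *\<^sub>C a n)) \<le> K * (r ^ n / fact n * norm (a n))"
        by (simp add: norm_scaleC norm_divide mult_ac)
    qed
  qed
  have A: "?A N = (\<Sum>m. (\<kappa> N m / fact m) *\<^sub>C a m)" for N
  proof -
    let ?z = "circle_point r N"
    have 1: "(\<lambda>m. (exp (- ?z j * \<beta>) / ?z j ^ k) *\<^sub>C ((?z j ^ m / fact m) *\<^sub>C a m))
        sums ((exp (- ?z j * \<beta>) / ?z j ^ k) *\<^sub>C (\<Sum>m. (?z j ^ m / fact m) *\<^sub>C a m))" for j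
      by (intro bounded_linear.sums[OF bounded_linear_scaleC_right] summable_sums summ[of _ 1])
        (simp add: norm_power norm_circle_point r)
    have "(\<lambda>m. (\<Sum>j<N. (exp (- ?z j * \<beta>) / ?z j ^ k) *\<^sub>C ((?z j ^ m / fact m) *\<^sub>C a m)) /\<^sub>R real N) sums ?A N"
      by (intro sums_scaleR_right sums_sum 1)
    moreover have "(\<Sum>j<N. (exp (- ?z j * \<beta>) / ?z j ^ k) *\<^sub>C ((?z j ^ m / fact m) *\<^sub>C a m)) /\<^sub>R real N
      = (\<kappa> N m / fact m) *\<^sub>C a m" for m
      unfolding scaleC_of_real[symmetric] scaleC_scaleC scaleC_sum_left[symmetric] \<kappa>_def
      by (rule arg_cong2[where f = scaleC])
         (simp_all add: sum_distrib_left sum_divide_distrib field_simps)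
    ultimately show ?thesis by (simp add: sums_iff)
  qed
  have L: "?L = (\<Sum>m. (\<kappa>' m / fact m) *\<^sub>C a m)"
  proof -
    have "(\<Sum>m. (\<kappa>' m / fact m) *\<^sub>C a m) = (\<Sum>m\<le>k. (\<kappa>' m / fact m) *\<^sub>C a m)"
      by (rule suminf_finite) (auto simp: \<kappa>'_def scaleC_zero_left)
    also have "\<dots> = ?L"
      unfolding scaleC_of_real[symmetric] scaleC_sum_right scaleC_scaleC
      by (intro sum.cong refl arg_cong2[where f = scaleC])
         (simp add: \<kappa>'_def binomial_fact field_simps)
    finally show ?thesis by simp
  qed
  \<comment> \<open>Tannery's theorem is applied to a real series dominating the norm of the
    vector-valued difference.\<close>
  have "(\<lambda>N. \<Sum>m. cmod (\<kappa> N m - \<kappa>' m) / fact m * norm (a m)) \<longlonglongrightarrow> (\<Sum>m. 0 / fact m * norm (a m))"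
  proof (rule tannerys_theorem[THEN conjunct2, THEN conjunct2])
    show "(\<lambda>N. cmod (\<kappa> N m - \<kappa>' m) / fact m * norm (a m)) \<longlonglongrightarrow> 0 / fact m * norm (a m)" for m
      by (intro tendsto_intros tendsto_norm_zero LIM_zero lim) simp
    have "norm (cmod (\<kappa> N m - \<kappa>' m) / fact m * norm (a m)) \<le> (2 * B) * (r ^ m / fact m * norm (a m))" for N m
    proof -
      have "cmod (\<kappa> N m - \<kappa>' m) \<le> r ^ m * (2 * B)"
        using norm_triangle_ineq4[of "\<kappa> N m" "\<kappa>' m"] \<kappa>_le[of N m] \<kappa>'_le[of m] by (simp add: algebra_simps)
      then have "cmod (\<kappa> N m - \<kappa>' m) / fact m * norm (a m) \<le> r ^ m * (2 * B) / fact m * norm (a m)"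
        by (intro mult_right_mono divide_right_mono) auto
      then show ?thesis by (simp add: mult_ac)
    qed
    then show "eventually (\<lambda>(m, N). norm (cmod (\<kappa> N m - \<kappa>' m) / fact m * norm (a m))
        \<le> (2 * B) * (r ^ m / fact m * norm (a m))) (at_top \<times>\<^sub>F sequentially)"
      by (intro always_eventually) auto
    show "summable (\<lambda>m. (2 * B) * (r ^ m / fact m * norm (a m)))" by (rule summable_mult[OF a])
  qed simp
  then have lim0: "(\<lambda>N. \<Sum>m. cmod (\<kappa> N m - \<kappa>' m) / fact m * norm (a m)) \<longlonglongrightarrow> 0" by simp
  have le: "norm (?A N - ?L) \<le> (\<Sum>m. cmod (\<kappa> N m - \<kappa>' m) / fact m * norm (a m))" for N
  proof -
    have "?A N - ?L = (\<Sum>m. ((\<kappa> N m - \<kappa>' m) / fact m) *\<^sub>C a m)"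
      unfolding A L using summ[OF \<kappa>_le] summ[OF \<kappa>'_le]
      by (subst suminf_diff) (auto simp: diff_divide_distrib scaleC_diff_left)
    also have "norm \<dots> \<le> (\<Sum>m. norm (((\<kappa> N m - \<kappa>' m) / fact m) *\<^sub>C a m))"
    proof (rule summable_norm, rule summable_comparison_test)
      show "summable (\<lambda>m. (2 * B) * (r ^ m / fact m * norm (a m)))" by (rule summable_mult[OF a])
      show "\<exists>n0. \<forall>m\<ge>n0. norm (norm (((\<kappa> N m - \<kappa>' m) / fact m) *\<^sub>C a m)) \<le> (2 * B) * (r ^ m / fact m * norm (a m))"
      proof (intro exI allI impI)
        fix m
        have "cmod (\<kappa> N m - \<kappa>' m) \<le> r ^ m * (2 * B)"
          using norm_triangle_ineq4[of "\<kappa> N m" "\<kappa>' m"] \<kappa>_le[of N m] \<kappa>'_le[of m] by (simp add: algebra_simps)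
        then have "cmod (\<kappa> N m - \<kappa>' m) / fact m * norm (a m) \<le> r ^ m * (2 * B) / fact m * norm (a m)"
          by (intro mult_right_mono divide_right_mono) auto
        then show "norm (norm (((\<kappa> N m - \<kappa>' m) / fact m) *\<^sub>C a m)) \<le> (2 * B) * (r ^ m / fact m * norm (a m))"
          by (simp add: norm_scaleC norm_divide mult_ac)
      qed
    qed
    finally show ?thesis by (simp add: norm_scaleC norm_divide)
  qed
  have "(\<lambda>N. ?A N - ?L) \<longlonglongrightarrow> 0"
    by (rule Lim_null_comparison[OF always_eventually[OF allI] lim0]) (rule le)
  then show ?thesis by (rule LIM_zero_cancel)
qed

section \<open>The conjugation argument\<close>

text \<open>Jensen's inequality for a convex power: the tangent at the mean \<open>c\<close> lies
  below the power, and its linear part averages to zero. An empty mean falls under the zero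
  case.\<close>

lemma power_mean_powr:
  fixes y :: "nat \<Rightarrow> real"
  assumes y: "\<And>j. 0 \<le> y j" and q: "1 \<le> q"
  shows "((\<Sum>j<N. y j) / real N) powr q \<le> (\<Sum>j<N. y j powr q) / real N"
proof (cases "(\<Sum>j<N. y j) = 0")
  case True
  then show ?thesis by (simp add: sum_nonneg)
next
  case False
  define c where "c = (\<Sum>j<N. y j) / real N"
  have N: "N > 0" using False by (cases N) auto
  have "0 \<le> (\<Sum>j<N. y j)" by (intro sum_nonneg y)
  then have c: "0 < c" using False N unfolding c_def by (intro divide_pos_pos) auto
  have bernoulli: "1 + q * (t - 1) \<le> t powr q" if "0 \<le> t" for t
  proof (cases "q = 1")
    case True
    then show ?thesis using that by simp
  next
    case False
    then have "t \<le> 1 / q * t powr q + (1 - 1 / q)"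
      using powr_mult_powr_le[of "1/q" "1 - 1/q" "t powr q" 1] that q by (simp add: powr_powr)
    then have "q * t \<le> q * (1 / q * t powr q + (1 - 1 / q))" using q by (intro mult_left_mono) auto
    also have "\<dots> = t powr q + q - 1" using q by (simp add: field_simps)
    finally show ?thesis by (simp add: algebra_simps)
  qed
  have "c powr q = (\<Sum>j<N. c powr q * (1 + q * (y j / c - 1))) / real N"
  proof -
    have "(\<Sum>j<N. c powr q * (1 + q * (y j / c - 1))) = c powr q * (real N + q * ((\<Sum>j<N. y j) / c - real N))"
      by (simp add: sum_distrib_left[symmetric] sum.distrib sum_subtractf sum_divide_distrib[symmetric])
    also have "(\<Sum>j<N. y j) / c = real N" using False N by (simp add: c_def)
    finally show ?thesis using N by simp
  qed
  also have "\<dots> \<le> (\<Sum>j<N. y j powr q) / real N"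
  proof (intro divide_right_mono sum_mono)
    fix j
    have "c powr q * (1 + q * (y j / c - 1)) \<le> c powr q * (y j / c) powr q"
      using bernoulli[of "y j / c"] y c by (intro mult_left_mono) auto
    also have "\<dots> = y j powr q" using y c by (simp add: powr_divide)
    finally show "c powr q * (1 + q * (y j / c - 1)) \<le> y j powr q" .
  qed simp
  finally show ?thesis by (simp add: c_def)
qed

section \<open>Finite sums under almost everywhere linearity, and the exponential remainder\<close>

lemma function_space_add: "function_space D \<Longrightarrow> f \<in> D \<Longrightarrow> g \<in> D \<Longrightarrow> (\<lambda>y. f y + g y) \<in> D"
  and function_space_cmult: "function_space D \<Longrightarrow> f \<in> D \<Longrightarrow> (\<lambda>y. c * f y) \<in> D"
  unfolding function_space_def by auto

lemma linear_operator_add: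
    "linear_operator D S \<Longrightarrow> f \<in> D \<Longrightarrow> g \<in> D \<Longrightarrow> AE x in lebesgue. S (\<lambda>y. f y + g y) x = S f x + S g x"
  and linear_operator_cmult:
    "linear_operator D S \<Longrightarrow> f \<in> D \<Longrightarrow> AE x in lebesgue. S (\<lambda>y. c * f y) x = c *\<^sub>C S f x"
  unfolding linear_operator_def by auto

lemma linear_operator_sum:
  fixes S :: "(real^'n \<Rightarrow> complex) \<Rightarrow> real^'n \<Rightarrow> 'b::complex_banach"
  assumes D: "function_space D" and S: "linear_operator D S" and "finite I" and "\<And>i. i \<in> I \<Longrightarrow> h i \<in> D"
  shows "(\<lambda>y. \<Sum>i\<in>I. h i y) \<in> D \<and> (AE x in lebesgue. S (\<lambda>y. \<Sum>i\<in>I. h i y) x = (\<Sum>i\<in>I. S (h i) x))"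
  using assms(3,4)
proof (induction I rule: finite_induct)
  case empty
  have "(\<lambda>y. 0) \<in> D" using D by (simp add: function_space_def)
  \<comment> \<open>The value of \<open>S\<close> at the zero function comes from homogeneity with
    the scalar 0.\<close>
  moreover from this have "AE x in lebesgue. S (\<lambda>y. 0 * 0) x = 0 *\<^sub>C S (\<lambda>y. 0) x"
    by (rule linear_operator_cmult[OF S])
  ultimately show ?case by (simp add: scaleC_zero_left)
next
  case (insert i I)
  have 1: "h i \<in> D" "(\<lambda>y. \<Sum>i\<in>I. h i y) \<in> D"
    and 2: "AE x in lebesgue. S (\<lambda>y. \<Sum>i\<in>I. h i y) x = (\<Sum>i\<in>I. S (h i) x)"
    using insert by auto
  have "AE x in lebesgue. S (\<lambda>y. h i y + (\<Sum>i\<in>I. h i y)) x = S (h i) x + S (\<lambda>y. \<Sum>i\<in>I. h i y) x"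
    by (rule linear_operator_add[OF S 1])
  then have "AE x in lebesgue. S (\<lambda>y. h i y + (\<Sum>i\<in>I. h i y)) x = S (h i) x + (\<Sum>i\<in>I. S (h i) x)"
    using 2 by eventually_elim simp
  moreover have "(\<lambda>y. h i y + (\<Sum>i\<in>I. h i y)) \<in> D"
    by (rule function_space_add[OF D 1])
  ultimately show ?case using insert.hyps by simp
qed

text \<open>Writing \<open>|x| ^ n = \<mu> ^ n (|x| / \<mu>) ^ n\<close> and using
  \<open>\<mu> ^ n \<le> \<mu> ^ M\<close> in the tail gains a geometric factor in \<open>M\<close>
  at the cost of a larger exponent.\<close>

lemma exp_remainder_le:
  fixes x :: complex
  assumes "0 < \<mu>" "\<mu> \<le> 1"
  shows "cmod (exp x - (\<Sum>m<M. x ^ m / fact m)) \<le> \<mu> ^ M * exp (cmod x / \<mu>)"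
proof -
  have "(\<lambda>n. x ^ (n + M) / fact (n + M)) sums (exp x - (\<Sum>m<M. x ^ m / fact m))"
    by (rule sums_split_initial_segment[OF exp_sums_divide])
  then have eq: "exp x - (\<Sum>m<M. x ^ m / fact m) = (\<Sum>n. x ^ (n + M) / fact (n + M))"
    by (simp add: sums_iff)
  define t where "t n = (cmod x / \<mu>) ^ n / fact n" for n
  have t: "t sums exp (cmod x / \<mu>)" unfolding t_def by (rule real_exp_sums_divide)
  have t0: "0 \<le> t n" for n using assms by (simp add: t_def)
  have le: "norm (x ^ (n + M) / fact (n + M)) \<le> \<mu> ^ M * t (n + M)" for n
  proof -
    have "norm (x ^ (n + M) / fact (n + M)) = \<mu> ^ (n + M) * t (n + M)"
      using assms by (simp add: t_def norm_divide norm_power power_divide)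
    also have "\<dots> \<le> \<mu> ^ M * t (n + M)"
      using assms t0 by (intro mult_right_mono power_decreasing) auto
    finally show ?thesis .
  qed
  have st: "summable t" using t by (simp add: sums_iff)
  then have st': "summable (\<lambda>n. \<mu> ^ M * t (n + M))" by (intro summable_mult) (simp add: summable_iff_shift)
  have "norm (\<Sum>n. x ^ (n + M) / fact (n + M)) \<le> (\<Sum>n. \<mu> ^ M * t (n + M))"
    by (rule norm_suminf_le[OF le st'])
  also have "\<dots> = \<mu> ^ M * (\<Sum>n. t (n + M))"
    using st by (intro suminf_mult) (simp add: summable_iff_shift)
  also have "(\<Sum>n. t (n + M)) \<le> suminf t"
    using suminf_split_initial_segment[OF st, of M] t0 by (simp add: sum_nonneg)
  also have "suminf t = exp (cmod x / \<mu>)" using t by (simp add: sums_iff)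
  finally show ?thesis using assms unfolding eq by (simp add: mult_left_mono)
qed

text \<open>What remains of the hypothesis once Muckenhoupt constants are estimated: one constant
  \<Phi> for all weights \<open>w exp (Re (z b))\<close> with \<open>|z| \<le> r\<close>. Both
  operators are kept because \<open>T\<close> carries measurability and norm bounds while
  \<open>S\<close> carries linearity.\<close>

locale conjugated_bounds =
  fixes D :: "(real^'n \<Rightarrow> complex) set"
    and T :: "(real^'n \<Rightarrow> complex) \<Rightarrow> real^'n \<Rightarrow> complex"
    and S :: "(real^'n \<Rightarrow> complex) \<Rightarrow> real^'n \<Rightarrow> 'b::complex_banach"
    and p q r \<Phi> F :: real and w :: "real^'n \<Rightarrow> real" and b f :: "real^'n \<Rightarrow> complex"
  assumes D: "function_space D" and lin: "linear_operator D S"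
    and T_meas: "\<And>g. g \<in> D \<Longrightarrow> T g \<in> borel_measurable lebesgue"
    and T_norm: "\<And>g. g \<in> D \<Longrightarrow> AE x in lebesgue. cmod (T g x) = norm (S g x)"
    and pq: "1 \<le> p" "1 \<le> q" and r_pos: "0 < r" and \<Phi>: "0 \<le> \<Phi>" and F: "0 \<le> F"
    and w_meas[measurable]: "w \<in> borel_measurable lebesgue"
    and w_nonneg: "\<And>x. 0 \<le> w x" and w_pos: "AE x in lebesgue. 0 < w x"
    and b_meas[measurable]: "b \<in> borel_measurable lebesgue"
    and f_meas[measurable]: "f \<in> borel_measurable lebesgue"
    and f_norm: "(\<integral>\<^sup>+ x. ennreal (cmod (f x) powr p * w x powr p) \<partial>lebesgue) \<le> ennreal (F powr p)"
    and bound: "\<And>z g C. cmod z \<le> r \<Longrightarrow> g \<in> borel_measurable lebesgue \<Longrightarrow> 0 \<le> C \<Longrightarrow>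
      (\<integral>\<^sup>+ x. ennreal (cmod (g x) powr p * (w x * exp (Re (z * b x))) powr p) \<partial>lebesgue) \<le> ennreal (C powr p) \<Longrightarrow>
      g \<in> D \<and> (\<integral>\<^sup>+ x. ennreal (cmod (T g x) powr q * (w x * exp (Re (z * b x))) powr q) \<partial>lebesgue)
        \<le> ennreal ((\<Phi> * C) powr q)"
begin

lemma bound_pointwise:
  assumes z: "cmod z \<le> r" and g: "g \<in> borel_measurable lebesgue" and K: "0 \<le> K"
    and le: "\<And>x. cmod (g x) * exp (Re (z * b x)) \<le> K * cmod (f x)"
  shows "g \<in> D"
    and "(\<integral>\<^sup>+ x. ennreal (cmod (T g x) powr q * (w x * exp (Re (z * b x))) powr q) \<partial>lebesgue)
        \<le> ennreal ((\<Phi> * (K * F)) powr q)"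
proof -
  have "(\<integral>\<^sup>+ x. ennreal (cmod (g x) powr p * (w x * exp (Re (z * b x))) powr p) \<partial>lebesgue)
      \<le> (\<integral>\<^sup>+ x. ennreal (K powr p) * ennreal (cmod (f x) powr p * w x powr p) \<partial>lebesgue)"
  proof (rule nn_integral_mono)
    fix x
    have "cmod (g x) powr p * (w x * exp (Re (z * b x))) powr p
        = ((cmod (g x) * exp (Re (z * b x))) * w x) powr p"
      using w_nonneg[of x] by (simp add: powr_mult mult_ac)
    also have "\<dots> \<le> ((K * cmod (f x)) * w x) powr p"
      using le w_nonneg[of x] pq by (intro powr_mono2 mult_right_mono) auto
    also have "\<dots> = K powr p * (cmod (f x) powr p * w x powr p)"
      using K w_nonneg[of x] by (simp add: powr_mult)
    finally show "ennreal (cmod (g x) powr p * (w x * exp (Re (z * b x))) powr p)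
      \<le> ennreal (K powr p) * ennreal (cmod (f x) powr p * w x powr p)"
      by (simp add: ennreal_leI flip: ennreal_mult)
  qed
  also have "\<dots> = ennreal (K powr p) * (\<integral>\<^sup>+ x. ennreal (cmod (f x) powr p * w x powr p) \<partial>lebesgue)"
    by (rule nn_integral_cmult) measurable
  also have "\<dots> \<le> ennreal (K powr p) * ennreal (F powr p)" by (intro mult_left_mono f_norm) auto
  also have "\<dots> = ennreal ((K * F) powr p)" using K F by (simp add: powr_mult flip: ennreal_mult)
  finally show "g \<in> D"
    "(\<integral>\<^sup>+ x. ennreal (cmod (T g x) powr q * (w x * exp (Re (z * b x))) powr q) \<partial>lebesgue)
        \<le> ennreal ((\<Phi> * (K * F)) powr q)"
    using bound[OF z g, of "K * F"] K F by auto
qed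

text \<open>
  A function dominated by \<open>exp (\<rho> |b|) |f|\<close> is a finite sum of pieces, each dominated by
  \<open>exp (r Re (\<omega> b)) |f|\<close> for one of finitely many directions \<open>\<omega>\<close>, to which the bound for
  \<open>z = - r \<omega>\<close> applies.
\<close>
lemma geometric_family:
  assumes g[measurable]: "\<And>m. g m \<in> borel_measurable lebesgue" and \<rho>: "0 < \<rho>" "\<rho> < r"
    and C: "0 \<le> C" and lam: "0 < lam" "lam < 1"
    and le: "\<And>m x. cmod (g m x) \<le> C * lam ^ m * exp (\<rho> * cmod (b x)) * cmod (f x)"
  shows "g m \<in> D" and "AE x in lebesgue. summable (\<lambda>m. norm (S (g m) x))"
proof -
  obtain W where W: "finite W" "\<And>\<omega>. \<omega> \<in> W \<Longrightarrow> cmod \<omega> \<le> 1"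
    "\<And>c. \<exists>\<omega>\<in>W. \<rho> / r * cmod c \<le> Re (\<omega> * c)"
    using finite_directions[of "\<rho> / r"] \<rho> by auto
  define E where "E \<omega> x \<longleftrightarrow> \<rho> * cmod (b x) \<le> r * Re (\<omega> * b x)" for \<omega> x
  \<comment> \<open>The sets \<open>E \<omega>\<close> cover the space but overlap; dividing by the
    number of sets containing \<open>x\<close> gives a partition of unity without choosing a
    direction.\<close>
  define cnt where "cnt x = (\<Sum>\<omega>\<in>W. if E \<omega> x then 1 else 0 :: real)" for x
  have cnt: "1 \<le> cnt x" for x
  proof -
    obtain \<omega> where "\<omega> \<in> W" "\<rho> / r * cmod (b x) \<le> Re (\<omega> * b x)" using W(3) by blast
    then have "\<omega> \<in> W" "E \<omega> x" using r_pos by (auto simp: E_def field_simps)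
    then show ?thesis unfolding cnt_def
      using member_le_sum[of \<omega> W "\<lambda>\<omega>. if E \<omega> x then 1 else 0 :: real"] W(1) by auto
  qed
  define h where "h \<omega> m = (\<lambda>x. if E \<omega> x then g m x / of_real (cnt x) else 0)" for \<omega> m
  have [measurable]: "Measurable.pred lebesgue (E \<omega>)" for \<omega> unfolding E_def by measurable
  have [measurable]: "cnt \<in> borel_measurable lebesgue" unfolding cnt_def by measurable
  have hm: "h \<omega> m \<in> borel_measurable lebesgue" for \<omega> m unfolding h_def by measurable
  have hg: "(\<lambda>x. \<Sum>\<omega>\<in>W. h \<omega> m x) = g m" for m
  proof
    fix x
    have "(\<Sum>\<omega>\<in>W. h \<omega> m x) = (\<Sum>\<omega>\<in>W. g m x / of_real (cnt x) * of_real (if E \<omega> x then 1 else 0))"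
      unfolding h_def by (intro sum.cong) auto
    also have "\<dots> = g m x / of_real (cnt x) * of_real (cnt x)"
      unfolding cnt_def by (simp only: of_real_sum sum_distrib_left)
    also have "\<dots> = g m x" using cnt[of x] by simp
    finally show "(\<Sum>\<omega>\<in>W. h \<omega> m x) = g m x" .
  qed
  \<comment> \<open>For \<open>z = - r \<omega>\<close> the weight cancels exactly the growth
    \<open>exp (r Re (\<omega> b))\<close> permitted on \<open>E \<omega>\<close>.\<close>
  have hle: "cmod (h \<omega> m x) * exp (Re (- of_real r * \<omega> * b x)) \<le> C * lam ^ m * cmod (f x)" for \<omega> m x
  proof (cases "E \<omega> x")
    case True
    have "cmod (h \<omega> m x) \<le> cmod (g m x)"
      using True cnt[of x] by (simp add: h_def norm_divide divide_le_eq mult_le_cancel_left1)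
    also have "\<dots> \<le> C * lam ^ m * exp (\<rho> * cmod (b x)) * cmod (f x)" by (rule le)
    also have "\<dots> \<le> C * lam ^ m * exp (r * Re (\<omega> * b x)) * cmod (f x)"
      using True C lam by (intro mult_left_mono mult_right_mono) (auto simp: E_def)
    finally have "cmod (h \<omega> m x) * exp (Re (- of_real r * \<omega> * b x))
        \<le> C * lam ^ m * exp (r * Re (\<omega> * b x)) * cmod (f x) * exp (Re (- of_real r * \<omega> * b x))"
      by (rule mult_right_mono) simp
    also have "\<dots> = C * lam ^ m * cmod (f x) * (exp (r * Re (\<omega> * b x)) * exp (- (r * Re (\<omega> * b x))))"
      by (simp add: algebra_simps)
    also have "\<dots> = C * lam ^ m * cmod (f x)" by (simp only: exp_minus_inverse mult_1_right)
    finally show ?thesis .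
  next
    case False
    then show ?thesis using C lam by (simp add: h_def)
  qed
  have zr: "cmod (- of_real r * \<omega>) \<le> r" if "\<omega> \<in> W" for \<omega>
    using W(2)[OF that] r_pos by (simp add: norm_mult)
  have Cl: "0 \<le> C * lam ^ m" for m using C lam by simp
  note P = bound_pointwise[OF zr hm Cl hle]
  have hD: "h \<omega> m \<in> D" if "\<omega> \<in> W" for \<omega> m using P(1)[OF that] .
  have L: "g m \<in> D \<and> (AE x in lebesgue. S (g m) x = (\<Sum>\<omega>\<in>W. S (h \<omega> m) x))" for m
    using linear_operator_sum[OF D lin W(1), of "\<lambda>\<omega>. h \<omega> m"] hD unfolding hg by simp
  show "g m \<in> D" using L by blast
  have summ: "AE x in lebesgue. summable (\<lambda>m. norm (S (h \<omega> m) x))" if "\<omega> \<in> W" for \<omega>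
  proof -
    \<comment> \<open>Summability is proved for the measurable functions
      \<open>T (h \<omega> m)\<close> and then carried over to the norms of
      \<open>S\<close>.\<close>
    have "AE x in lebesgue. summable (\<lambda>m. cmod (T (h \<omega> m) x))"
    proof (rule AE_summable_if_geometric)
      show "(\<integral>\<^sup>+ x. ennreal (cmod (T (h \<omega> m) x) powr q * (w x * exp (Re (- of_real r * \<omega> * b x))) powr q) \<partial>lebesgue)
        \<le> ennreal ((\<Phi> * C * F * lam ^ m) powr q)" for m
        using P(2)[OF that, of m] by (simp add: mult_ac)
      show "(\<lambda>x. cmod (T (h \<omega> m) x)) \<in> borel_measurable lebesgue" for m
        using T_meas[OF hD[OF that]] by measurable
      show "(\<lambda>x. (w x * exp (Re (- of_real r * \<omega> * b x))) powr q) \<in> borel_measurable lebesgue"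
        by measurable
      show "AE x in lebesgue. 0 < (w x * exp (Re (- of_real r * \<omega> * b x))) powr q"
        using w_pos by eventually_elim simp
    qed (use pq C \<Phi> F lam in auto)
    moreover have "AE x in lebesgue. \<forall>m. cmod (T (h \<omega> m) x) = norm (S (h \<omega> m) x)"
      using T_norm[OF hD[OF that]] by (simp add: AE_all_countable)
    ultimately show ?thesis by eventually_elim simp
  qed
  have "AE x in lebesgue. \<forall>\<omega>\<in>W. summable (\<lambda>m. norm (S (h \<omega> m) x))"
    using summ W(1) by (simp add: AE_ball_countable countable_finite)
  moreover have "AE x in lebesgue. \<forall>m. S (g m) x = (\<Sum>\<omega>\<in>W. S (h \<omega> m) x)"
    using L by (simp add: AE_all_countable)
  ultimately show "AE x in lebesgue. summable (\<lambda>m. norm (S (g m) x))"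
  proof eventually_elim
    case (elim x)
    show ?case
    proof (rule summable_comparison_test)
      show "summable (\<lambda>m. \<Sum>\<omega>\<in>W. norm (S (h \<omega> m) x))"
        using elim(1) by (intro summable_sum) auto
      show "\<exists>N. \<forall>m\<ge>N. norm (norm (S (g m) x)) \<le> (\<Sum>\<omega>\<in>W. norm (S (h \<omega> m) x))"
        using elim(2) by (auto intro: norm_sum)
    qed
  qed
qed

text \<open>For \<rho> strictly between \<open>t\<close> and \<open>r\<close>,
  \<open>(t |b|) ^ m / m!\<close> equals \<open>(t / \<rho>) ^ m\<close> times one term of the
  series of \<open>exp (\<rho> |b|)\<close>, so \<open>geometric_family\<close> applies.\<close>

lemma power_coeff_family:
  assumes t: "0 < t" "t < r"
  shows "(\<lambda>y. b y ^ m * f y) \<in> D"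
    and "AE x in lebesgue. summable (\<lambda>m. t ^ m / fact m * norm (S (\<lambda>y. b y ^ m * f y) x))"
proof -
  define \<rho> where "\<rho> = (t + r) / 2"
  have \<rho>: "0 < \<rho>" "\<rho> < r" "t < \<rho>" using t by (auto simp: \<rho>_def)
  define g where "g m = (\<lambda>y. of_real (t ^ m / fact m) * (b y ^ m * f y))" for m
  have gm: "g m \<in> borel_measurable lebesgue" for m unfolding g_def by measurable
  have le: "cmod (g m x) \<le> 1 * (t / \<rho>) ^ m * exp (\<rho> * cmod (b x)) * cmod (f x)" for m x
  proof -
    have "cmod (g m x) = (t / \<rho>) ^ m * ((\<rho> * cmod (b x)) ^ m / fact m) * cmod (f x)"
      using t \<rho> by (simp add: g_def norm_mult norm_divide norm_power power_divide power_mult_distrib)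
    also have "\<dots> \<le> (t / \<rho>) ^ m * exp (\<rho> * cmod (b x)) * cmod (f x)"
    proof (intro mult_right_mono mult_left_mono)
      have "(\<rho> * cmod (b x)) ^ m / fact m = (\<Sum>n\<in>{m}. (\<rho> * cmod (b x)) ^ n / fact n)" by simp
      also have "\<dots> \<le> exp (\<rho> * cmod (b x))"
        using sum_le_suminf[of "\<lambda>n. (\<rho> * cmod (b x)) ^ n / fact n" "{m}"]
          real_exp_sums_divide[of "\<rho> * cmod (b x)"] \<rho> by (simp add: sums_iff)
      finally show "(\<rho> * cmod (b x)) ^ m / fact m \<le> exp (\<rho> * cmod (b x))" .
    qed (use t \<rho> in auto)
    finally show ?thesis by simp
  qed
  have lam: "0 < t / \<rho>" "t / \<rho> < 1" using t \<rho> by auto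
  note G = geometric_family[OF gm \<rho>(1,2) zero_le_one lam le]
  have bm: "(\<lambda>y. b y ^ m * f y) = (\<lambda>y. of_real (fact m / t ^ m) * g m y)" for m
    using t by (auto simp: g_def)
  have bD: "(\<lambda>y. b y ^ m * f y) \<in> D" for m
    unfolding bm by (rule function_space_cmult[OF D G(1)])
  then show "(\<lambda>y. b y ^ m * f y) \<in> D" .
  have "AE x in lebesgue. S (g m) x = of_real (t ^ m / fact m) *\<^sub>C S (\<lambda>y. b y ^ m * f y) x" for m
    unfolding g_def by (rule linear_operator_cmult[OF lin bD])
  then have "AE x in lebesgue. \<forall>m. S (g m) x = of_real (t ^ m / fact m) *\<^sub>C S (\<lambda>y. b y ^ m * f y) x"
    by (simp add: AE_all_countable)
  with G(2) show "AE x in lebesgue. summable (\<lambda>m. t ^ m / fact m * norm (S (\<lambda>y. b y ^ m * f y) x))"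
  proof eventually_elim
    case (elim x)
    then show ?case using t by (simp add: norm_scaleC norm_divide norm_power)
  qed
qed

text \<open>The norm bound is the one at \<open>- z\<close>, where the weight undoes the modulus of
  \<open>exp (z b)\<close>. The series holds because the Taylor remainders \<open>R M\<close>, with
  the room between \<open>t\<close> and \<open>r\<close>, form a geometric family: the norms of
  \<open>S (R M)\<close> are summable almost everywhere and hence tend to zero.\<close>

lemma exp_conjugate:
  assumes z: "cmod z \<le> t" and t: "0 < t" "t < r"
  shows "(\<lambda>y. exp (z * b y) * f y) \<in> D"
    and "(\<integral>\<^sup>+ x. ennreal (cmod (T (\<lambda>y. exp (z * b y) * f y) x) powr q
        * (w x * exp (Re (- z * b x))) powr q) \<partial>lebesgue) \<le> ennreal ((\<Phi> * F) powr q)"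
    and "AE x in lebesgue. S (\<lambda>y. exp (z * b y) * f y) x
        = (\<Sum>m. (z ^ m / fact m) *\<^sub>C S (\<lambda>y. b y ^ m * f y) x)"
proof -
  define e where "e = (\<lambda>y. exp (z * b y) * f y)"
  have zr: "cmod (- z) \<le> r" using z t by simp
  have em: "e \<in> borel_measurable lebesgue" unfolding e_def by measurable
  have ele: "cmod (e x) * exp (Re (- z * b x)) \<le> 1 * cmod (f x)" for x
  proof -
    have "cmod (e x) * exp (Re (- z * b x)) = cmod (f x) * (exp (Re (z * b x)) * exp (- Re (z * b x)))"
      by (simp add: e_def norm_mult)
    then show ?thesis by (simp only: exp_minus_inverse)
  qed
  note P = bound_pointwise[OF zr em zero_le_one ele]
  show eD: "(\<lambda>y. exp (z * b y) * f y) \<in> D" using P(1) by (simp add: e_def)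
  show "(\<integral>\<^sup>+ x. ennreal (cmod (T (\<lambda>y. exp (z * b y) * f y) x) powr q
        * (w x * exp (Re (- z * b x))) powr q) \<partial>lebesgue) \<le> ennreal ((\<Phi> * F) powr q)"
    using P(2) by (simp add: e_def)
  define \<rho> where "\<rho> = (t + r) / 2"
  have \<rho>: "0 < \<rho>" "\<rho> < r" "t < \<rho>" using t by (auto simp: \<rho>_def)
  define a where "a m = (\<lambda>y. b y ^ m * f y)" for m
  define R where "R M = (\<lambda>y. (exp (z * b y) - (\<Sum>m<M. (z * b y) ^ m / fact m)) * f y)" for M
  have Rm: "R M \<in> borel_measurable lebesgue" for M unfolding R_def by measurable
  have lam: "0 < t / \<rho>" "t / \<rho> < 1" using t \<rho> by auto
  have Rle: "cmod (R M x) \<le> 1 * (t / \<rho>) ^ M * exp (\<rho> * cmod (b x)) * cmod (f x)" for M x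
  proof -
    have "cmod (exp (z * b x) - (\<Sum>m<M. (z * b x) ^ m / fact m))
        \<le> (t / \<rho>) ^ M * exp (cmod (z * b x) / (t / \<rho>))"
      by (rule exp_remainder_le) (use lam in auto)
    also have "cmod (z * b x) / (t / \<rho>) \<le> \<rho> * cmod (b x)"
    proof -
      have "cmod (z * b x) \<le> t * cmod (b x)" using z by (simp add: norm_mult mult_right_mono)
      then have "cmod (z * b x) / (t / \<rho>) \<le> t * cmod (b x) / (t / \<rho>)"
        using lam by (intro divide_right_mono) auto
      also have "\<dots> = \<rho> * cmod (b x)" using t by simp
      finally show ?thesis .
    qed
    finally show ?thesis using lam by (simp add: R_def norm_mult mult_left_mono mult_right_mono)
  qed
  note G = geometric_family[OF Rm \<rho>(1,2) zero_le_one lam Rle]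
  have aD: "a m \<in> D" for m unfolding a_def by (rule power_coeff_family(1)[OF t])
  have caD: "(\<lambda>y. z ^ m / fact m * a m y) \<in> D" for m
    by (rule function_space_cmult[OF D aD])
  have Sa: "AE x in lebesgue. \<forall>m. S (\<lambda>y. z ^ m / fact m * a m y) x = (z ^ m / fact m) *\<^sub>C S (a m) x"
    unfolding AE_all_countable by (intro allI linear_operator_cmult[OF lin aD])
  have "AE x in lebesgue. S e x = (\<Sum>m<M. S (\<lambda>y. z ^ m / fact m * a m y) x) + S (R M) x" for M
  proof -
    have L: "(\<lambda>y. \<Sum>m<M. z ^ m / fact m * a m y) \<in> D"
      "AE x in lebesgue. S (\<lambda>y. \<Sum>m<M. z ^ m / fact m * a m y) x = (\<Sum>m<M. S (\<lambda>y. z ^ m / fact m * a m y) x)"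
      using linear_operator_sum[OF D lin, of "{..<M}" "\<lambda>m y. z ^ m / fact m * a m y"] caD by auto
    have "e = (\<lambda>y. (\<Sum>m<M. z ^ m / fact m * a m y) + R M y)"
    proof
      fix y
      have "(\<Sum>m<M. z ^ m / fact m * a m y) = (\<Sum>m<M. (z * b y) ^ m / fact m) * f y"
        unfolding a_def sum_distrib_right by (intro sum.cong refl) (simp add: power_mult_distrib)
      then show "e y = (\<Sum>m<M. z ^ m / fact m * a m y) + R M y"
        by (simp add: e_def R_def left_diff_distrib)
    qed
    moreover have "AE x in lebesgue. S (\<lambda>y. (\<Sum>m<M. z ^ m / fact m * a m y) + R M y) x
        = S (\<lambda>y. \<Sum>m<M. z ^ m / fact m * a m y) x + S (R M) x"
      by (rule linear_operator_add[OF lin L(1) G(1)])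
    ultimately have "AE x in lebesgue. S e x = S (\<lambda>y. \<Sum>m<M. z ^ m / fact m * a m y) x + S (R M) x"
      by simp
    with L(2) show ?thesis by eventually_elim simp
  qed
  then have "AE x in lebesgue. \<forall>M. S e x = (\<Sum>m<M. S (\<lambda>y. z ^ m / fact m * a m y) x) + S (R M) x"
    by (simp add: AE_all_countable)
  with G(2) Sa have "AE x in lebesgue. S e x = (\<Sum>m. (z ^ m / fact m) *\<^sub>C S (a m) x)"
  proof eventually_elim
    case (elim x)
    have "(\<lambda>M. S (R M) x) \<longlonglongrightarrow> 0"
      using summable_LIMSEQ_zero[OF elim(1)] by (rule tendsto_norm_zero_cancel)
    then have "(\<lambda>M. S e x - S (R M) x) \<longlonglongrightarrow> S e x - 0" by (intro tendsto_intros)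
    moreover have "S e x - S (R M) x = (\<Sum>m<M. (z ^ m / fact m) *\<^sub>C S (a m) x)" for M
    proof -
      have "S e x = (\<Sum>m<M. (z ^ m / fact m) *\<^sub>C S (a m) x) + S (R M) x"
        using elim(2,3) by simp
      then show ?thesis by simp
    qed
    ultimately have "(\<lambda>m. (z ^ m / fact m) *\<^sub>C S (a m) x) sums S e x" by (simp add: sums_def)
    then show ?case by (rule sums_unique)
  qed
  then show "AE x in lebesgue. S (\<lambda>y. exp (z * b y) * f y) x
        = (\<Sum>m. (z ^ m / fact m) *\<^sub>C S (\<lambda>y. b y ^ m * f y) x)"
    by (simp only: e_def a_def)
qed

end

context conjugated_bounds
begin

text \<open>
  The Cauchy integral formula over \<open>|z| = t\<close> is replaced by means over roots of unity: they
  involve only countably many \<open>z\<close>, hence countably many null sets, and no measurability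
  of the vector-valued functions \<open>S g\<close>.
\<close>
lemma iter_commutator_bound:
  assumes t: "0 < t" "t < r"
  shows "(\<integral>\<^sup>+ x. ennreal (norm (iter_commutator k S b f x) powr q * w x powr q) \<partial>lebesgue)
    \<le> ennreal ((fact k / t ^ k * (\<Phi> * F)) powr q)"
proof -
  define e where "e z = (\<lambda>y. exp (z * b y) * f y)" for z
  define a where "a x m = S (\<lambda>y. b y ^ m * f y) x" for x m
  define \<zeta> where "\<zeta> N j = circle_point t N j" for N j
  have \<zeta>: "cmod (\<zeta> N j) = t" for N j by (simp add: \<zeta>_def norm_circle_point t)
  note X = exp_conjugate[OF eq_refl[OF \<zeta>] t, folded e_def]
  define A where "A N x = (\<Sum>j<N. (exp (- \<zeta> N j * b x) / \<zeta> N j ^ k) *\<^sub>C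
    (\<Sum>m. (\<zeta> N j ^ m / fact m) *\<^sub>C a x m)) /\<^sub>R real N" for N x
  define c where "c = fact k / t ^ k"
  have c: "0 \<le> c" using t by (simp add: c_def)
  define G where "G N j x = cmod (T (e (\<zeta> N j)) x) powr q * (w x * exp (Re (- \<zeta> N j * b x))) powr q" for N j x
  have Gm: "G N j \<in> borel_measurable lebesgue" for N j
    unfolding G_def using T_meas[OF X(1), of N j] by measurable
  have G0: "0 \<le> G N j x" for N j x by (simp add: G_def)
  \<comment> \<open>The majorants \<open>U\<close> are built from \<open>T\<close> and are
    measurable; the approximants \<open>l\<close> are built from \<open>S\<close> and need not
    be.\<close>
  define U where "U N x = ennreal (c powr q * ((\<Sum>j<N. G N j x) / real N))" for N x
  define l where "l N x = ennreal ((fact k * norm (A N x)) powr q * w x powr q)" for N x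
  have AEs: "AE x in lebesgue. \<forall>N j. S (e (\<zeta> N j)) x = (\<Sum>m. (\<zeta> N j ^ m / fact m) *\<^sub>C a x m)"
    "AE x in lebesgue. \<forall>N j. cmod (T (e (\<zeta> N j)) x) = norm (S (e (\<zeta> N j)) x)"
    unfolding AE_all_countable using X(3) T_norm[OF X(1)] by (simp_all add: a_def)
  have summ: "AE x in lebesgue. summable (\<lambda>m. t ^ m / fact m * norm (a x m))"
    unfolding a_def by (rule power_coeff_family(2)[OF t])
  show ?thesis unfolding c_def[symmetric]
  proof (rule nn_integral_dominated_limit_le[where U = U and l = l])
    show "U N \<in> borel_measurable lebesgue" for N
      unfolding U_def using Gm by measurable
    show "AE x in lebesgue. (\<lambda>N. l N x) \<longlonglongrightarrow> ennreal (norm (iter_commutator k S b f x) powr q * w x powr q)"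
      using summ
    proof eventually_elim
      case (elim x)
      have "(\<lambda>N. A N x) \<longlonglongrightarrow> iter_commutator k S b f x /\<^sub>R fact k"
        unfolding A_def \<zeta>_def iter_commutator_eq_sum a_def[symmetric]
        by (rule conjugated_series_mean_tendsto[OF t(1) elim])
      then have "(\<lambda>N. (fact k * norm (A N x)) powr q * w x powr q)
          \<longlonglongrightarrow> (fact k * norm (iter_commutator k S b f x /\<^sub>R fact k)) powr q * w x powr q"
        using pq by (intro tendsto_intros tendsto_powr') auto
      moreover have "fact k * norm (iter_commutator k S b f x /\<^sub>R fact k) = norm (iter_commutator k S b f x)"
        by (simp add: field_simps)
      ultimately show ?case unfolding l_def by (intro tendsto_ennrealI) (simp only:)
    qed
    show "AE x in lebesgue. \<forall>N. l N x \<le> U N x"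
      using AEs
    proof eventually_elim
      case (elim x)
      show ?case
      proof
        fix N
        define y where "y j = exp (Re (- \<zeta> N j * b x)) * cmod (T (e (\<zeta> N j)) x)" for j
        have y0: "0 \<le> y j" for j by (simp add: y_def)
        have "norm (A N x) \<le> (\<Sum>j<N. y j / t ^ k) / real N"
        proof -
          have "norm (\<Sum>j<N. (exp (- \<zeta> N j * b x) / \<zeta> N j ^ k) *\<^sub>C (\<Sum>m. (\<zeta> N j ^ m / fact m) *\<^sub>C a x m))
              \<le> (\<Sum>j<N. y j / t ^ k)"
          proof (rule sum_norm_le)
            fix j
            show "norm ((exp (- \<zeta> N j * b x) / \<zeta> N j ^ k) *\<^sub>C (\<Sum>m. (\<zeta> N j ^ m / fact m) *\<^sub>C a x m)) \<le> y j / t ^ k"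
              using elim by (simp add: norm_scaleC norm_divide norm_power \<zeta> y_def flip: elim(1)[rule_format])
          qed
          then show ?thesis unfolding A_def by (simp add: divide_inverse mult.commute mult_left_mono)
        qed
        also have "\<dots> = (\<Sum>j<N. y j) / real N / t ^ k" by (simp flip: sum_divide_distrib)
        finally have "fact k * norm (A N x) \<le> fact k * ((\<Sum>j<N. y j) / real N / t ^ k)"
          by (rule mult_left_mono) simp
        also have "\<dots> = c * ((\<Sum>j<N. y j) / real N)" by (simp add: c_def)
        finally have "(fact k * norm (A N x)) powr q \<le> (c * ((\<Sum>j<N. y j) / real N)) powr q"
          using pq by (intro powr_mono2) auto
        also have "\<dots> = c powr q * ((\<Sum>j<N. y j) / real N) powr q"
          using c y0 by (intro powr_mult) 
        \<comment> \<open>Moving the power inside the mean lets each node be integrated against its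
          own conjugated weight.\<close>
        also have "\<dots> \<le> c powr q * ((\<Sum>j<N. y j powr q) / real N)"
          by (intro mult_left_mono power_mean_powr y0 pq) simp
        finally have "(fact k * norm (A N x)) powr q * w x powr q
            \<le> c powr q * ((\<Sum>j<N. y j powr q) / real N) * w x powr q"
          by (rule mult_right_mono) simp
        also have "\<dots> = c powr q * ((\<Sum>j<N. G N j x) / real N)"
        proof -
          have "y j powr q * w x powr q = G N j x" for j
            using w_nonneg[of x] by (simp add: y_def G_def powr_mult mult_ac)
          then have "(\<Sum>j<N. y j powr q) * w x powr q = (\<Sum>j<N. G N j x)"
            by (simp add: sum_distrib_right)
          then show ?thesis by (metis (no_types) mult.assoc times_divide_eq_left)
        qed
        finally show "l N x \<le> U N x" unfolding l_def U_def by (rule ennreal_leI)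
      qed
    qed
    fix N :: nat
    assume N: "0 < N"
    \<comment> \<open>Every node satisfies the same integral bound, so the mean does too, uniformly
      in \<open>N\<close>.\<close>
    have "integral\<^sup>N lebesgue (U N) = (\<integral>\<^sup>+x. ennreal (c powr q / real N) * (\<Sum>j<N. ennreal (G N j x)) \<partial>lebesgue)"
      unfolding U_def using G0
      by (intro nn_integral_cong) (simp add: sum_nonneg divide_inverse mult_ac flip: ennreal_mult)
    also have "\<dots> = ennreal (c powr q / real N) * (\<Sum>j<N. \<integral>\<^sup>+x. ennreal (G N j x) \<partial>lebesgue)"
      using Gm by (subst nn_integral_cmult) (auto simp: nn_integral_sum)
    also have "\<dots> \<le> ennreal (c powr q / real N) * (\<Sum>j<N. ennreal ((\<Phi> * F) powr q))"
      unfolding G_def by (intro mult_left_mono sum_mono X(2)) simp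
    also have "\<dots> = ennreal (c powr q / real N * (real N * (\<Phi> * F) powr q))"
      by (simp add: ennreal_of_nat_eq_real_of_nat flip: ennreal_mult)
    also have "c powr q / real N * (real N * (\<Phi> * F) powr q) = (c * (\<Phi> * F)) powr q"
      using N c \<Phi> F by (simp add: powr_mult)
    finally show "integral\<^sup>N lebesgue (U N) \<le> ennreal ((c * (\<Phi> * F)) powr q)" .
  qed
qed

end

text \<open>For each \<open>t\<close> above the norm of \<open>b\<close>, a \<beta> strictly between
  them gives an admissible radius \<open>r\<close> and a smaller Cauchy radius \<tau>; then
  \<open>t\<close> decreases to the norm. Only the modulus of \<open>R\<close> is prescribed, so
  that linear and linearizable operators are treated at once.\<close>

lemma iter_commutator_Lp_bound:
  fixes D :: "(real^'n \<Rightarrow> complex) set"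
    and S :: "(real^'n \<Rightarrow> complex) \<Rightarrow> real^'n \<Rightarrow> 'b::complex_banach"
  assumes D: "function_space D" and lin: "linear_operator D S"
    and Tm: "\<And>f. f \<in> D \<Longrightarrow> T f \<in> borel_measurable lebesgue"
    and TS: "\<And>f. f \<in> D \<Longrightarrow> AE x in lebesgue. cmod (T f x) = norm (S f x)"
    and pq: "1 \<le> p" "1 \<le> q" and \<theta>: "0 < \<theta>" and s: "1 < s"
    and \<phi>: "mono_on {1..} \<phi>" "\<And>t. 1 \<le> t \<Longrightarrow> 0 \<le> \<phi> t"
    and hyp: "\<And>w f. weight w \<Longrightarrow> in_Ap s (\<lambda>x. w x powr \<theta>) \<Longrightarrow> f \<in> Lp_space p (\<lambda>x. w x powr p) \<Longrightarrow>
      f \<in> D \<and> Lp_norm q (\<lambda>x. w x powr q) (T f)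
        \<le> ennreal (\<phi> (Ap_const s (\<lambda>x. w x powr \<theta>))) * Lp_norm p (\<lambda>x. w x powr p) f"
    and b: "b \<in> BMO" and w: "weight w" and \<eta>: "1 < \<eta>" "1 / \<eta> + 1 / \<eta>' = 1"
    and Ap: "in_Ap s (\<lambda>x. w x powr (\<theta> * \<eta>))" and f: "f \<in> Lp_space p (\<lambda>x. w x powr p)"
    and R: "\<And>x. cmod (R x) = norm (iter_commutator k S b f x)"
  shows "Lp_norm q (\<lambda>x. w x powr q) R
    \<le> ennreal (fact k * (\<eta>' * \<theta> / min 1 (s - 1)) ^ k
        * \<phi> (4 powr (min 1 (s - 1) / \<eta>') * Ap_const s (\<lambda>x. w x powr (\<theta> * \<eta>)) powr (1 / \<eta>)))
      * BMO_norm b ^ k * Lp_norm p (\<lambda>x. w x powr p) f"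
proof -
  define m where "m = min 1 (s - 1)"
  have m: "0 < m" using s by (simp add: m_def)
  have \<eta>': "0 < \<eta>'"
  proof -
    have "1 / \<eta>' = 1 - 1 / \<eta>" using \<eta>(2) by simp
    also have "\<dots> > 0" using \<eta>(1) by simp
    finally show ?thesis by simp
  qed
  define K where "K = 4 powr (m / \<eta>') * Ap_const s (\<lambda>x. w x powr (\<theta> * \<eta>)) powr (1 / \<eta>)"
  define \<Phi> where "\<Phi> = \<phi> K"
  \<comment> \<open>Both factors are at least 1; this keeps \<phi> inside its range of monotonicity
    and non-negativity.\<close>
  have K: "1 \<le> K"
  proof -
    have "1 \<le> (4::real) powr (m / \<eta>')" using m \<eta>' by (intro ge_one_powr_ge_zero) auto
    moreover have "1 \<le> Ap_const s (\<lambda>x. w x powr (\<theta> * \<eta>)) powr (1 / \<eta>)"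
      using Ap_const_ge_1[OF Ap s] \<eta> by (intro ge_one_powr_ge_zero) auto
    ultimately show ?thesis unfolding K_def using mult_mono by fastforce
  qed
  have \<Phi>0: "0 \<le> \<Phi>" unfolding \<Phi>_def by (rule \<phi>(2)[OF K])
  have w0: "\<And>x. 0 \<le> w x" and [measurable]: "w \<in> borel_measurable lebesgue"
    using w unfolding weight_def by (auto intro: locally_integrable_borel_measurable)
  have wpos: "AE x in lebesgue. 0 < w x"
  proof -
    have "AE x in lebesgue. 0 < w x powr (\<theta> * \<eta>)" using Ap by (simp add: in_Ap_def)
    then show ?thesis
    proof eventually_elim
      case (elim x)
      then show ?case using w0[of x] by (cases "w x = 0") auto
    qed
  qed
  have [measurable]: "b \<in> borel_measurable lebesgue"
    using b unfolding BMO_def by (auto intro: locally_integrable_borel_measurable)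
  obtain F where F: "0 \<le> F" "Lp_norm p (\<lambda>x. w x powr p) f = ennreal F" "f \<in> borel_measurable lebesgue"
    using Lp_spaceE[OF f] .
  have fint: "(\<integral>\<^sup>+ x. ennreal (cmod (f x) powr p * w x powr p) \<partial>lebesgue) \<le> ennreal (F powr p)"
    using Lp_norm_le_iff[of p F "\<lambda>x. w x powr p" f] F pq by simp
  define B where "B = enn2real (BMO_norm b)"
  have B: "0 \<le> B" "BMO_norm b = ennreal B"
    using b by (auto simp: B_def BMO_def)
  define c where "c = fact k * (\<eta>' * \<theta> / m) ^ k * \<Phi> * F"
  have c0: "0 \<le> c" using \<eta>' \<theta> m \<Phi>0 F by (simp add: c_def)
  have le: "Lp_norm q (\<lambda>x. w x powr q) R \<le> ennreal (c * t ^ k)" if tB: "B < t" for t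
  proof -
    define \<beta> where "\<beta> = (B + t) / 2"
    have \<beta>: "0 < \<beta>" "B < \<beta>" "\<beta> < t" "0 < t" using tB B(1) by (auto simp: \<beta>_def)
    define r where "r = m / (\<eta>' * \<theta> * \<beta>)"
    \<comment> \<open>Chosen with \<open>t\<close> in place of \<beta>, so that
      \<open>1 / \<tau> ^ k\<close> is \<open>(\<eta>' * \<theta> / m) ^ k * t ^ k\<close>, and
      below \<open>r\<close> because \<open>\<beta> < t\<close>.\<close>
    define \<tau> where "\<tau> = m / (\<eta>' * \<theta> * t)"
    have r: "0 < r" "0 < \<tau>" "\<tau> < r"
      using m \<eta>' \<theta> \<beta> by (auto simp: r_def \<tau>_def intro!: divide_strict_left_mono mult_pos_pos)
    have b\<beta>: "BMO_norm b < ennreal \<beta>" using B \<beta> by (simp add: ennreal_less_iff)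
    interpret conjugated_bounds D T S p q r \<Phi> F w b f
    proof (unfold_locales; (intro D lin Tm TS pq r(1) \<Phi>0 F(1) w0 wpos F(3) fint; assumption)?)
      fix z and g :: "real^'n \<Rightarrow> complex" and C :: real
      assume z: "cmod z \<le> r" and g: "g \<in> borel_measurable lebesgue" and C: "0 \<le> C"
        "(\<integral>\<^sup>+ x. ennreal (cmod (g x) powr p * (w x * exp (Re (z * b x))) powr p) \<partial>lebesgue) \<le> ennreal (C powr p)"
      note P = Ap_BMO_exponential[OF w Ap s \<theta> \<eta> b b\<beta> \<beta>(1) z[unfolded r_def m_def]]
      have v0: "0 \<le> w x * exp (Re (z * b x))" for x using w0[of x] by simp
      show "g \<in> D \<and> (\<integral>\<^sup>+ x. ennreal (cmod (T g x) powr q * (w x * exp (Re (z * b x))) powr q) \<partial>lebesgue)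
        \<le> ennreal ((\<Phi> * C) powr q)"
        unfolding \<Phi>_def
        using weighted_bound_extends[OF hyp Tm pq \<theta> s \<phi> v0 P(1) P(2)[folded m_def, folded K_def] g C] by blast
    qed auto
    have "(\<integral>\<^sup>+ x. ennreal (cmod (R x) powr q * w x powr q) \<partial>lebesgue)
        \<le> ennreal ((fact k / \<tau> ^ k * (\<Phi> * F)) powr q)"
      unfolding R by (rule iter_commutator_bound[OF r(2,3)])
    also have "fact k / \<tau> ^ k * (\<Phi> * F) = c * t ^ k"
      by (simp add: c_def \<tau>_def power_divide power_mult_distrib)
    finally show ?thesis
      using Lp_norm_le_iff[of q "c * t ^ k" "\<lambda>x. w x powr q" R] pq c0 \<beta> by simp
  qed
  have "Lp_norm q (\<lambda>x. w x powr q) R \<le> ennreal (c * B ^ k)"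
  \<comment> \<open>The right limit at \<open>B\<close> also covers a vanishing norm, where no
    finite radius would be optimal.\<close>
  proof (rule tendsto_lowerbound)
    show "((\<lambda>t. ennreal (c * t ^ k)) \<longlongrightarrow> ennreal (c * B ^ k)) (at_right B)"
      by (intro tendsto_ennrealI tendsto_intros)
    show "eventually (\<lambda>t. Lp_norm q (\<lambda>x. w x powr q) R \<le> ennreal (c * t ^ k)) (at_right B)"
      using le by (auto simp: eventually_at_right_field intro!: exI[of _ "B + 1"])
  qed simp
  also have "c * B ^ k = (fact k * (\<eta>' * \<theta> / m) ^ k * \<Phi>) * B ^ k * F" by (simp add: c_def mult_ac)
  also have "ennreal \<dots> = ennreal (fact k * (\<eta>' * \<theta> / m) ^ k * \<Phi>) * ennreal B ^ k * ennreal F"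
    using \<eta>' \<theta> m \<Phi>0 F B by (simp add: ennreal_mult ennreal_power)
  finally show ?thesis unfolding F(2) B(2) \<Phi>_def K_def m_def .
qed

theorem theorem3p1:
  fixes D :: "(real^'n \<Rightarrow> complex) set"
    and T :: "(real^'n \<Rightarrow> complex) \<Rightarrow> real^'n \<Rightarrow> complex"
    and S :: "(real^'n \<Rightarrow> complex) \<Rightarrow> real^'n \<Rightarrow> 'b::complex_banach"
    and Tcomm :: "nat \<Rightarrow> (real^'n \<Rightarrow> complex) \<Rightarrow> (real^'n \<Rightarrow> complex) \<Rightarrow> real^'n \<Rightarrow> complex"
    and p q \<theta> s :: real
    and \<phi> :: "real \<Rightarrow> real"
  assumes "function_space D"
    and "\<And>f. f \<in> D \<Longrightarrow> T f \<in> borel_measurable lebesgue"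
    and "linear_operator D T \<and> (\<forall>k b f. Tcomm k b f = iter_commutator k T b f)
      \<or> linearized_by D T S
        \<and> (\<forall>k b f. Tcomm k b f = (\<lambda>x. complex_of_real (norm (iter_commutator k S b f x))))"
    and "1 \<le> p" and "1 \<le> q" and "0 < \<theta>" and "1 < s"
    and "mono_on {1..} \<phi>" and "\<And>t. 1 \<le> t \<Longrightarrow> 0 \<le> \<phi> t"
    and "\<And>w f. weight w \<Longrightarrow> in_Ap s (\<lambda>x. w x powr \<theta>) \<Longrightarrow> f \<in> Lp_space p (\<lambda>x. w x powr p) \<Longrightarrow>
      f \<in> D \<and> Lp_norm q (\<lambda>x. w x powr q) (T f)
        \<le> ennreal (\<phi> (Ap_const s (\<lambda>x. w x powr \<theta>))) * Lp_norm p (\<lambda>x. w x powr p) f"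
  shows "\<forall>b\<in>BMO. \<forall>w \<eta> \<eta>'. weight w \<and> 1 < \<eta> \<and> 1 / \<eta> + 1 / \<eta>' = 1
      \<and> in_Ap s (\<lambda>x. w x powr (\<theta> * \<eta>)) \<longrightarrow>
    (\<forall>f\<in>Lp_space p (\<lambda>x. w x powr p).
      Lp_norm q (\<lambda>x. w x powr q) (Tcomm 1 b f)
        \<le> ennreal (\<eta>' * \<theta> / min 1 (s - 1)
            * \<phi> (4 powr (min 1 (s - 1) / \<eta>') * Ap_const s (\<lambda>x. w x powr (\<theta> * \<eta>)) powr (1 / \<eta>)))
          * BMO_norm b * Lp_norm p (\<lambda>x. w x powr p) f
      \<and> (\<forall>k\<ge>2.
        Lp_norm q (\<lambda>x. w x powr q) (Tcomm k b f)
        \<le> ennreal (fact k * (\<eta>' * \<theta> / min 1 (s - 1)) ^ k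
            * \<phi> (4 powr (min 1 (s - 1) / \<eta>') * Ap_const s (\<lambda>x. w x powr (\<theta> * \<eta>)) powr (1 / \<eta>)))
          * BMO_norm b ^ k * Lp_norm p (\<lambda>x. w x powr p) f))"
proof (intro ballI allI impI)
  fix b f :: "real^'n \<Rightarrow> complex" and w :: "real^'n \<Rightarrow> real" and \<eta> \<eta>' :: real
  assume b: "b \<in> BMO" and f: "f \<in> Lp_space p (\<lambda>x. w x powr p)"
    and A: "weight w \<and> 1 < \<eta> \<and> 1 / \<eta> + 1 / \<eta>' = 1 \<and> in_Ap s (\<lambda>x. w x powr (\<theta> * \<eta>))"
  have main: "Lp_norm q (\<lambda>x. w x powr q) (Tcomm k b f)
    \<le> ennreal (fact k * (\<eta>' * \<theta> / min 1 (s - 1)) ^ k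
        * \<phi> (4 powr (min 1 (s - 1) / \<eta>') * Ap_const s (\<lambda>x. w x powr (\<theta> * \<eta>)) powr (1 / \<eta>)))
      * BMO_norm b ^ k * Lp_norm p (\<lambda>x. w x powr p) f" for k
    using assms(3)
  proof (elim disjE conjE)
    assume T: "linear_operator D T" and C: "\<forall>k b f. Tcomm k b f = iter_commutator k T b f"
    \<comment> \<open>A linear operator is treated as its own linearization, with the complex
      numbers as target and \<open>S = T\<close>.\<close>
    show ?thesis
      by (rule iter_commutator_Lp_bound[OF assms(1) T assms(2) _ assms(4-10) b]) (use A f C in auto)
  next
    assume S: "linearized_by D T S"
      and C: "\<forall>k b f. Tcomm k b f = (\<lambda>x. complex_of_real (norm (iter_commutator k S b f x)))"
    have "AE x in lebesgue. cmod (T g x) = norm (S g x)" if "g \<in> D" for g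
    proof -
      have "AE x in lebesgue. T g x = complex_of_real (norm (S g x))"
        using S that by (simp add: linearized_by_def)
      then show ?thesis by eventually_elim simp
    qed
    moreover have "linear_operator D S" using S by (simp add: linearized_by_def)
    ultimately show ?thesis
      by (intro iter_commutator_Lp_bound[OF assms(1) _ assms(2) _ assms(4-10) b, where S = S]) (use A f C in auto)
  qed
  show "Lp_norm q (\<lambda>x. w x powr q) (Tcomm 1 b f)
        \<le> ennreal (\<eta>' * \<theta> / min 1 (s - 1)
            * \<phi> (4 powr (min 1 (s - 1) / \<eta>') * Ap_const s (\<lambda>x. w x powr (\<theta> * \<eta>)) powr (1 / \<eta>)))
          * BMO_norm b * Lp_norm p (\<lambda>x. w x powr p) f
      \<and> (\<forall>k\<ge>2.
        Lp_norm q (\<lambda>x. w x powr q) (Tcomm k b f)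
        \<le> ennreal (fact k * (\<eta>' * \<theta> / min 1 (s - 1)) ^ k
            * \<phi> (4 powr (min 1 (s - 1) / \<eta>') * Ap_const s (\<lambda>x. w x powr (\<theta> * \<eta>)) powr (1 / \<eta>)))
          * BMO_norm b ^ k * Lp_norm p (\<lambda>x. w x powr p) f)"
    using main[of 1] main by simp
qed

end
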